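(* Let $\rho \in \mathcal{S}$ with $\rho > 0$ and $\sigma\in\mathcal{P}$ with $\sigma > 0$ such that $\rho\sigma\neq\sigma\rho$. Then for every $\alpha \in (0, \frac12)$, $D_{\alpha}^{\mathbb{P}}(\rho\|\sigma) > D_{\alpha}(\rho\|\sigma)$. In particular, there is a measurement in a fixed orthonormal basis (rank-one projective measurement) whose outcome distributions $P,Q$ satisfy $D_\alpha(P\|Q)>D_\alpha(\rho\|\sigma)$, so the sandwiched Rényi relative entropy violates the data-processing inequality for $\alpha\in(0,\frac12)$.
   Context: Work on a $d$-dimensional complex Hilbert space; $\mathcal{P}$ positive semidefinite operators, $\mathcal{S}$ density operators, $\log$ natural logarithm. The sandwiched Rényi relative entropy is $D_\alpha(\rho\|\sigma)=\frac{1}{\alpha-1}\log \operatorname{tr}\big[(\sigma^{\frac{1-\alpha}{2\alpha}}\rho\sigma^{\frac{1-\alpha}{2\alpha}})^\alpha\big]$. For $\alpha\in(0,1)$, the projectively measured Rényi relative entropy is $D^{\mathbb{P}}_\alpha(\rho\|\sigma)=\frac{1}{\alpha-1}\log \min_{\{P_i\}_{i=1}^d}\sum_i \operatorname{tr}[P_i\rho]^\alpha\operatorname{tr}[P_i\sigma]^{1-\alpha}$, minimum over families of $d$ mutually orthogonal rank-one projectors. For finite distributions, $D_\alpha(P\|Q)=\frac{1}{\alpha-1}\log\sum_x P(x)^\alpha Q(x)^{1-\alpha}$. *)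

theory Defs
  imports Complex_Main "Jordan_Normal_Form.Matrix"
begin

definition adj :: "complex mat \<Rightarrow> complex mat" where
  "adj A = mat (dim_col A) (dim_row A) (\<lambda>(i,j). cnj (A $$ (j,i)))"

definition mtrace :: "complex mat \<Rightarrow> complex" where
  "mtrace A = (\<Sum>i<dim_row A. A $$ (i,i))"

definition cinner :: "complex vec \<Rightarrow> complex vec \<Rightarrow> complex" where
  "cinner v w = (\<Sum>i<dim_vec v. cnj (v $ i) * w $ i)"

definition pos_def :: "nat \<Rightarrow> complex mat \<Rightarrow> bool" where
  "pos_def d A \<longleftrightarrow> A \<in> carrier_mat d d \<and> adj A = A \<and>
     (\<forall>v \<in> carrier_vec d. v \<noteq> 0\<^sub>v d \<longrightarrow> Re (cinner v (A *\<^sub>v v)) > 0)"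

definition pos_semidef :: "nat \<Rightarrow> complex mat \<Rightarrow> bool" where
  "pos_semidef d A \<longleftrightarrow> A \<in> carrier_mat d d \<and> adj A = A \<and>
     (\<forall>v \<in> carrier_vec d. Re (cinner v (A *\<^sub>v v)) \<ge> 0)"

definition density :: "nat \<Rightarrow> complex mat \<Rightarrow> bool" where
  "density d A \<longleftrightarrow> pos_semidef d A \<and> mtrace A = 1"

definition unitary :: "nat \<Rightarrow> complex mat \<Rightarrow> bool" where
  "unitary d U \<longleftrightarrow> U \<in> carrier_mat d d \<and> adj U * U = 1\<^sub>m d"

text \<open>Functional calculus for Hermitian matrices via a spectral decomposition
  A = U diag(lambda) U^*; f(A) = U diag(f lambda) U^* (independent of the choice).\<close>
definition mat_fun :: "nat \<Rightarrow> (real \<Rightarrow> real) \<Rightarrow> complex mat \<Rightarrow> complex mat" where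
  "mat_fun d f A = (let (U, lam) = (SOME (U, lam). unitary d U \<and>
       A = U * mat_diag d (\<lambda>i. complex_of_real (lam i)) * adj U)
     in U * mat_diag d (\<lambda>i. complex_of_real (f (lam i))) * adj U)"

definition sandwiched_renyi :: "nat \<Rightarrow> real \<Rightarrow> complex mat \<Rightarrow> complex mat \<Rightarrow> real" where
  "sandwiched_renyi d \<alpha> \<rho> \<sigma> =
     (let S = mat_fun d (\<lambda>x. x powr ((1 - \<alpha>) / (2 * \<alpha>))) \<sigma> in
      1 / (\<alpha> - 1) * ln (Re (mtrace (mat_fun d (\<lambda>x. x powr \<alpha>) (S * \<rho> * S)))))"

definition onb :: "nat \<Rightarrow> complex vec list \<Rightarrow> bool" where
  "onb d vs \<longleftrightarrow> length vs = d \<and> set vs \<subseteq> carrier_vec d \<and>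
     (\<forall>i<d. \<forall>j<d. cinner (vs ! i) (vs ! j) = (if i = j then 1 else 0))"

definition proj :: "complex vec \<Rightarrow> complex mat" where
  "proj v = mat (dim_vec v) (dim_vec v) (\<lambda>(i,j). v $ i * cnj (v $ j))"

text \<open>tr[P rho] for P = |v><v| (real since both are Hermitian).\<close>
definition outcome_prob :: "complex vec \<Rightarrow> complex mat \<Rightarrow> real" where
  "outcome_prob v A = Re (mtrace (proj v * A))"

definition classical_renyi :: "real \<Rightarrow> (nat \<Rightarrow> real) \<Rightarrow> (nat \<Rightarrow> real) \<Rightarrow> nat set \<Rightarrow> real" where
  "classical_renyi \<alpha> P Q X = 1 / (\<alpha> - 1) * ln (\<Sum>x\<in>X. P x powr \<alpha> * Q x powr (1 - \<alpha>))"

text \<open>Projectively measured Renyi relative entropy (alpha in (0,1)); the minimum over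
  rank-one projective measurements is written as an infimum (it is attained).\<close>
definition meas_renyi :: "nat \<Rightarrow> real \<Rightarrow> complex mat \<Rightarrow> complex mat \<Rightarrow> real" where
  "meas_renyi d \<alpha> \<rho> \<sigma> = 1 / (\<alpha> - 1) * ln (Inf
     {\<Sum>i<d. outcome_prob (vs ! i) \<rho> powr \<alpha> * outcome_prob (vs ! i) \<sigma> powr (1 - \<alpha>) | vs. onb d vs})"

end

theory Submission
  imports Defs "Jordan_Normal_Form.Spectral_Radius" "HOL-Complex_Analysis.Conformal_Mappings"
begin

text \<open>
  Write X = S \<rho> S with S = \<sigma>^((1-\<alpha>)/(2\<alpha>)) and r = \<alpha>/(1-\<alpha>) < 1. Measuring in an eigenbasis
  of \<omega> = S X^(\<alpha>-1) S, the weighted AM-GM inequality bounds the sum of p^\<alpha> q^(1-\<alpha>) by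
  \<alpha> tr[\<rho> \<omega>] + (1-\<alpha>) tr[\<sigma> \<omega>^(-r)]. The first trace equals tr[X^\<alpha>], and the second is strictly
  smaller than tr[X^\<alpha>] by the strict Araki-Lieb-Thirring inequality
  tr[A^r B^r] < tr[(B^(1/2) A B^(1/2))^r] for noncommuting A, B.
  For 1/2 \<le> r < 1 the latter follows from the three lines theorem. For r < 1/2, the statement for r/(1-r)
  yields a measurement as above with \<alpha> = r, and the data-processing inequality of the Petz-Renyi quantity
  tr[A^r B^(1-r)] then yields the statement for r.
\<close>

section \<open>The spectral theorem for Hermitian matrices\<close>

hide_const (open) Nonnegative_Lebesgue_Integration.density Finite_Cartesian_Product.mat
  Finite_Cartesian_Product.vec Finite_Cartesian_Product.row Determinants.det
no_notation Finite_Cartesian_Product.vec.vec_nth (infixl \<open>$\<close> 90)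

declare index_mult_mat(1) [simp del] sum.lessThan_Suc [simp del]

text \<open>The threshold \<alpha> = 1/2 is r = 1, where the two sides of the Araki-Lieb-Thirring
  inequality agree by cyclicity of the trace. The operator \<omega> is found by optimisation: with Y
  = S \<omega>^(-1) S the first trace is tr[X Y^(-1)], and the inequality for A = \<omega>^(-1), B =
  \<sigma>^(1/r) bounds the second by tr[Y^r]. The expression \<alpha> tr[X Y^(-1)] + (1-\<alpha>)
  tr[Y^r] is stationary at Y = X^(1-\<alpha>), where both traces equal tr[X^\<alpha>]. All
  strictness thus comes from the second trace, through the equality case of the maximum modulus
  principle. The obstacle is that the interpolation uses Young's inequality with weight 1/(2r),
  which is at most 1 only for r \<ge> 1/2; this forces the detour for small r. The Petz-Renyi bound
  serves a second time at the end: it keeps the infimum over all bases away from 0, so its logarithm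
  can be compared.\<close>

lemma mult_carrier_square [simp]:
  "A \<in> carrier_mat d d \<Longrightarrow> B \<in> carrier_mat d d \<Longrightarrow> A * B \<in> carrier_mat d d"
  by (rule mult_carrier_mat)

lemma adj_carrier [simp]: "A \<in> carrier_mat n m \<Longrightarrow> adj A \<in> carrier_mat m n"
  by (auto simp: adj_def)

lemma adj_index [simp]: "A \<in> carrier_mat n m \<Longrightarrow> i < m \<Longrightarrow> j < n \<Longrightarrow> adj A $$ (i,j) = cnj (A $$ (j,i))"
  by (auto simp: adj_def)

lemma adj_adj [simp]: "adj (adj A) = A"
  by (rule eq_matI) (auto simp: adj_def)

lemma mult_index:
  assumes "A \<in> carrier_mat n m" "B \<in> carrier_mat m l" "i < n" "j < l"
  shows "(A * B) $$ (i,j) = (\<Sum>k<m. A $$ (i,k) * B $$ (k,j))"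
  using assms by (auto simp: index_mult_mat(1) scalar_prod_def atLeast0LessThan)

lemma adj_mult:
  assumes "A \<in> carrier_mat n m" "B \<in> carrier_mat m l"
  shows "adj (A * B) = adj B * adj A"
proof (rule eq_matI)
  fix i j assume "i < dim_row (adj B * adj A)" "j < dim_col (adj B * adj A)"
  then have ij: "i < l" "j < n" using assms by (auto simp: adj_def)
  then show "adj (A * B) $$ (i,j) = (adj B * adj A) $$ (i,j)"
    using assms by (simp add: mult_index[OF adj_carrier[OF assms(2)] adj_carrier[OF assms(1)]]
        mult_index[OF assms] adj_index[OF mult_carrier_mat[OF assms]] mult.commute)
qed (use assms in \<open>auto simp: adj_def\<close>)

lemma adj_mat_diag: "adj (mat_diag d g) = mat_diag d (\<lambda>i. cnj (g i))"
  by (rule eq_matI) (auto simp: adj_def mat_diag_def)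

lemma conj_diag_index:
  assumes "U \<in> carrier_mat d d" "i < d" "j < d"
  shows "(U * mat_diag d g * adj U) $$ (i,j) = (\<Sum>k<d. U $$ (i,k) * g k * cnj (U $$ (j,k)))"
  using assms by (simp add: mat_diag_mult_right mult_index[of _ d d _ d])

lemma unitaryD:
  assumes "unitary d U"
  shows unitary_carrier: "U \<in> carrier_mat d d" and "adj U * U = 1\<^sub>m d" and "U * adj U = 1\<^sub>m d"
  using assms mat_mult_left_right_inverse[of "adj U" d U] by (auto simp: unitary_def)

lemma unitary_mult:
  assumes "unitary d U" "unitary d V"
  shows "unitary d (U * V)"
proof -
  have C: "U \<in> carrier_mat d d" "V \<in> carrier_mat d d" using assms by (auto simp: unitary_def)
  have "adj (U * V) * (U * V) = adj V * ((adj U * U) * V)"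
    using C by (simp add: adj_mult[of _ d d _ d] assoc_mult_mat[of _ d d _ d _ d])
  then show ?thesis using assms C by (simp add: unitary_def)
qed

lemma unitary_adj: "unitary d U \<Longrightarrow> unitary d (adj U)"
  by (frule unitaryD(3)) (simp add: unitary_def)

text \<open>The reflection 1 - c u u^* with u = v - e_0 exchanges the unit vectors e_0 and v
  whenever their inner product t is real. Here c = 2 / |u|^2 = 1 / (1 - t), and t \<le> 0 keeps the
  denominator away from 0.\<close>

lemma householder:
  fixes v :: "nat \<Rightarrow> complex" and n d :: nat
  defines "d \<equiv> Suc n"
  assumes norm: "(\<Sum>i<d. v i * cnj (v i)) = 1" and v0: "v 0 = complex_of_real t" "t \<le> 0"
  obtains W where "unitary d W" "adj W = W" "\<And>i. i < d \<Longrightarrow> W $$ (i,0) = v i"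
proof
  define u where "u i = v i - (if i = 0 then 1 else 0)" for i
  define c where "c = complex_of_real (1 / (1 - t))"
  define W where "W = mat d d (\<lambda>(i,j). (if i = j then 1 else 0) - c * u i * cnj (u j))"
  have W: "W \<in> carrier_mat d d" by (simp add: W_def)
  have cc: "cnj c = c" by (simp add: c_def)
  show a: "adj W = W" by (rule eq_matI) (auto simp: adj_def W_def cc)
  have "(\<Sum>i<d. u i * cnj (u i)) = (\<Sum>i<n. v (Suc i) * cnj (v (Suc i))) + (of_real t - 1) * (of_real t - 1)"
    unfolding d_def by (simp add: sum.lessThan_Suc_shift u_def v0)
  moreover have "(\<Sum>i<n. v (Suc i) * cnj (v (Suc i))) = 1 - of_real t * of_real t"
    using norm unfolding d_def sum.lessThan_Suc_shift by (simp add: v0 algebra_simps)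
  ultimately have uu: "(\<Sum>i<d. u i * cnj (u i)) = 2 * (1 - of_real t)" by (simp add: algebra_simps)
  have "1 / (1 - t) * (1 - t) = 1" using v0 by simp
  then have ct: "c * (1 - of_real t) = 1" unfolding c_def by (metis of_real_1 of_real_diff of_real_mult)
  have cuu: "c * (\<Sum>i<d. u i * cnj (u i)) = 2" unfolding uu using ct by (metis mult.assoc mult.commute mult.right_neutral)
  have "W * W = 1\<^sub>m d"
  proof (rule eq_matI)
    fix i j assume "i < dim_row (1\<^sub>m d)" "j < dim_col (1\<^sub>m d)"
    then have ij: "i < d" "j < d" by auto
    have "(W * W) $$ (i,j) = (\<Sum>k<d. ((if i = k then 1 else 0) - c * u i * cnj (u k)) * ((if k = j then 1 else 0) - c * u k * cnj (u j)))"
      using ij by (simp add: mult_index[OF W W]) (simp add: W_def)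
    also have "\<dots> = (\<Sum>k<d. (if i = k then (if k = j then 1 else 0) - c * u k * cnj (u j) else 0)
        - (if k = j then c * u i * cnj (u k) else 0) + c * u i * cnj (u j) * c * (u k * cnj (u k)))"
      by (rule sum.cong) (auto simp: algebra_simps)
    also have "\<dots> = (if i = j then 1 else 0) - c * u i * cnj (u j) - c * u i * cnj (u j) + c * u i * cnj (u j) * (c * (\<Sum>k<d. u k * cnj (u k)))"
      using ij by (simp add: sum.distrib sum_subtractf sum_distrib_left mult.assoc)
    also have "\<dots> = 1\<^sub>m d $$ (i,j)" unfolding cuu using ij by simp
    finally show "(W * W) $$ (i,j) = 1\<^sub>m d $$ (i,j)" .
  qed (use W in auto)
  then show "unitary d W" using W by (simp add: unitary_def a)
  fix i assume i: "i < d"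
  have "cnj (u 0) = - (1 - of_real t)" by (simp add: u_def v0)
  then have "c * u i * cnj (u 0) = - (c * (1 - of_real t)) * u i" by (simp only: mult_minus_right mult_minus_left mult_ac)
  then show "W $$ (i,0) = v i" using i by (auto simp: W_def d_def ct u_def)
qed

text \<open>Deflation: a reflection W moves a unit eigenvector to e_0, so W A W splits off the
  eigenvalue and leaves a Hermitian block of size n for the induction hypothesis.\<close>

theorem spectral_decomposition:
  assumes "A \<in> carrier_mat d d" "adj A = A"
  shows "\<exists>U lam. unitary d U \<and> A = U * mat_diag d (\<lambda>i. complex_of_real (lam i)) * adj U"
  using assms
proof (induction d arbitrary: A)
  case 0
  then show ?case by (intro exI[of _ "1\<^sub>m 0"] exI[of _ "\<lambda>_. 0"]) (auto simp: unitary_def adj_def)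
next
  case (Suc n)
  define d where "d = Suc n"
  note A = Suc.prems(1)[folded d_def] and hA = Suc.prems(2)
  have "spectrum A \<noteq> {}" by (rule spectrum_non_empty[OF A]) (simp add: d_def)
  then obtain k w where "eigenvector A w k" by (auto simp: spectrum_def eigenvalue_def)
  then have w: "w \<in> carrier_vec d" "w \<noteq> 0\<^sub>v d" "A *\<^sub>v w = k \<cdot>\<^sub>v w" using A by (auto simp: eigenvector_def)
  define N where "N = (\<Sum>i<d. (cmod (w $ i))\<^sup>2)"
  obtain i0 where "i0 < d" "w $ i0 \<noteq> 0" using w by (metis eq_vecI carrier_vecD index_zero_vec)
  then have N: "N > 0" unfolding N_def by (intro sum_pos2[of _ i0]) auto
  \<comment> \<open>This phase makes the first entry of the normalised eigenvector real and
    nonpositive, as \<open>householder\<close> requires.\<close>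
  define ph where "ph = (if w $ 0 = 0 then 1 else - cnj (w $ 0) / cmod (w $ 0))"
  have phn: "cmod ph = 1" by (simp add: ph_def norm_divide)
  define c where "c = ph / sqrt N"
  have cc: "c * cnj c = 1 / N"
    using N phn by (simp add: c_def complex_norm_square[symmetric] flip: of_real_mult of_real_power)
  define v where "v i = c * w $ i" for i
  have "(\<Sum>i<d. v i * cnj (v i)) = (c * cnj c) * (\<Sum>i<d. w $ i * cnj (w $ i))"
    by (simp add: v_def sum_distrib_left algebra_simps)
  also have "\<dots> = 1" using N unfolding cc by (simp add: complex_norm_square[symmetric] N_def flip: of_real_power of_real_sum)
  finally have vn: "(\<Sum>i<d. v i * cnj (v i)) = 1" .
  have ww: "cnj (w $ 0) * w $ 0 = of_real (cmod (w $ 0)) * of_real (cmod (w $ 0))"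
    by (metis complex_norm_square mult.commute power2_eq_square of_real_power)
  have v0: "v 0 = complex_of_real (- cmod (w $ 0) / sqrt N)"
    by (auto simp: v_def c_def ph_def ww)
  have v0': "- cmod (w $ 0) / sqrt N \<le> 0" using N by (simp)
  obtain W where W: "unitary d W" "adj W = W" "\<And>i. i < d \<Longrightarrow> W $$ (i,0) = v i"
    using householder[of v n] vn v0 v0' unfolding d_def by metis
  have WC: "W \<in> carrier_mat d d" using W by (simp add: unitary_def)
  have WW: "W * W = 1\<^sub>m d" using W by (simp add: unitary_def)
  define B where "B = W * (A * W)"
  have B: "B \<in> carrier_mat d d" using A WC by (simp add: B_def)
  have hB: "adj B = B" unfolding B_def using A WC hA W
    by (simp add: adj_mult[of _ d d _ d] assoc_mult_mat[of _ d d _ d _ d])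
  have AW: "(A * W) $$ (i,0) = k * v i" if "i < d" for i
  proof -
    have "(A * W) $$ (i,0) = (\<Sum>j<d. A $$ (i,j) * v j)"
      using that by (simp add: mult_index[OF A WC] W d_def)
    also have "\<dots> = c * (A *\<^sub>v w) $ i"
      using that A w(1) by (simp add: scalar_prod_def sum_distrib_left v_def algebra_simps atLeast0LessThan)
    also have "\<dots> = k * v i" using that w(1) unfolding w(3) by (simp add: v_def)
    finally show ?thesis .
  qed
  have B0: "B $$ (i,0) = (if i = 0 then k else 0)" if "i < d" for i
  proof -
    have "B $$ (i,0) = (\<Sum>j<d. W $$ (i,j) * (k * v j))"
      unfolding B_def using that A WC by (subst mult_index[of _ d d _ d]) (auto simp: AW d_def)
    also have "\<dots> = k * (W * W) $$ (i,0)"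
      using that by (simp add: mult_index[OF WC WC] W sum_distrib_left algebra_simps d_def)
    finally show ?thesis using that by (simp add: WW d_def)
  qed
  \<comment> \<open>Hermiticity turns the cleared column into a cleared row and makes the eigenvalue
    real.\<close>
  have B0': "B $$ (0,i) = cnj (if i = 0 then k else 0)" if "i < d" for i
    using adj_index[OF B, of 0 i] that B0[OF that] by (simp add: hB d_def)
  have kr: "k = of_real (Re k)" using B0[of 0] B0'[of 0] by (simp add: d_def complex_eq_iff)
  define A' where "A' = mat n n (\<lambda>(i,j). B $$ (Suc i, Suc j))"
  have A': "A' \<in> carrier_mat n n" by (simp add: A'_def)
  have "adj A' = A'"
  proof (rule eq_matI)
    fix i j assume "i < dim_row A'" "j < dim_col A'"
    then have ij: "i < n" "j < n" using A' by auto
    then show "adj A' $$ (i,j) = A' $$ (i,j)" using adj_index[OF B, of "Suc i" "Suc j"] hB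
      by (simp add: adj_index[OF A']) (simp add: A'_def d_def)
  qed (use A' in \<open>auto simp: adj_def\<close>)
  from Suc.IH[OF A' this] obtain U' lam' where U': "unitary n U'"
    "A' = U' * mat_diag n (\<lambda>i. complex_of_real (lam' i)) * adj U'" by blast
  have UC': "U' \<in> carrier_mat n n" using U' by (simp add: unitary_def)
  \<comment> \<open>The direct sum of 1 and U', diagonalising both blocks of B at once.\<close>
  define V where "V = mat d d (\<lambda>(i,j). case (i,j) of (Suc i, Suc j) \<Rightarrow> U' $$ (i,j) | _ \<Rightarrow> if i = j then 1 else 0)"
  define lam where "lam i = (case i of 0 \<Rightarrow> Re k | Suc i \<Rightarrow> lam' i)" for i
  have V: "V \<in> carrier_mat d d" by (simp add: V_def)
  have V00: "V $$ (0,0) = 1" "\<And>j. j < n \<Longrightarrow> V $$ (0, Suc j) = 0" "\<And>j. j < n \<Longrightarrow> V $$ (Suc j, 0) = 0"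
    "\<And>i j. i < n \<Longrightarrow> j < n \<Longrightarrow> V $$ (Suc i, Suc j) = U' $$ (i,j)"
    by (auto simp: V_def d_def)
  have "adj V * V = 1\<^sub>m d"
  proof (rule eq_matI)
    fix i j assume "i < dim_row (1\<^sub>m d)" "j < dim_col (1\<^sub>m d)"
    then have ij: "i < d" "j < d" by auto
    have "(adj V * V) $$ (i,j) = (\<Sum>k<d. cnj (V $$ (k,i)) * V $$ (k,j))"
      using ij V by (simp add: mult_index[of _ d d _ d])
    also have "\<dots> = 1\<^sub>m d $$ (i,j)"
    proof -
      have "(\<Sum>k<n. cnj (U' $$ (k,i')) * U' $$ (k,j')) = (if i' = j' then 1 else 0)" if "i' < n" "j' < n" for i' j'
      proof -
        have "(\<Sum>k<n. cnj (U' $$ (k,i')) * U' $$ (k,j')) = (adj U' * U') $$ (i',j')"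
          using that UC' by (simp add: mult_index[of _ n n _ n])
        then show ?thesis using that U' by (simp add: unitary_def)
      qed
      then show ?thesis using ij unfolding d_def
        by (cases i; cases j) (auto simp: sum.lessThan_Suc_shift V00)
    qed
    finally show "(adj V * V) $$ (i,j) = 1\<^sub>m d $$ (i,j)" .
  qed (use V in \<open>auto simp: adj_def\<close>)
  then have uV: "unitary d V" using V by (simp add: unitary_def)
  have BV: "B = V * mat_diag d (\<lambda>i. complex_of_real (lam i)) * adj V"
  proof (rule eq_matI)
    fix i j assume "i < dim_row (V * mat_diag d (\<lambda>i. complex_of_real (lam i)) * adj V)"
      "j < dim_col (V * mat_diag d (\<lambda>i. complex_of_real (lam i)) * adj V)"
    then have ij: "i < d" "j < d" using V by (auto simp: adj_def)
    have *: "B $$ (Suc i', Suc j') = (\<Sum>k<n. U' $$ (i',k) * of_real (lam' k) * cnj (U' $$ (j',k)))"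
      if "i' < n" "j' < n" for i' j'
      using that conj_diag_index[OF UC' that, of "\<lambda>k. complex_of_real (lam' k)"] unfolding U'(2)[symmetric] by (simp add: A'_def)
    show "B $$ (i,j) = (V * mat_diag d (\<lambda>i. complex_of_real (lam i)) * adj V) $$ (i,j)"
      unfolding conj_diag_index[OF V ij] using ij B0 B0' kr unfolding d_def
      by (cases i; cases j) (auto simp: sum.lessThan_Suc_shift V00 * lam_def)
  qed (use B V in \<open>auto simp: adj_def\<close>)
  have "A = W * B * W" unfolding B_def using A WC WW
    by (simp add: assoc_mult_mat[of _ d d _ d _ d]) (simp add: WW flip: assoc_mult_mat[of _ d d _ d _ d])
  also have "\<dots> = (W * V) * mat_diag d (\<lambda>i. complex_of_real (lam i)) * adj (W * V)"
    unfolding BV using WC V W by (simp add: adj_mult[of _ d d _ d] assoc_mult_mat[of _ d d _ d _ d])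
  finally show ?case using unitary_mult[OF W(1) uV] unfolding d_def by blast
qed

section \<open>Functional calculus and positive definite matrices\<close>

lemma mult_assoc_square:
  "A \<in> carrier_mat d d \<Longrightarrow> B \<in> carrier_mat d d \<Longrightarrow> E \<in> carrier_mat d d \<Longrightarrow> A * B * E = A * (B * E)"
  by (rule assoc_mult_mat)

lemma mult_one_square [simp]:
  fixes A :: "complex mat"
  shows "A \<in> carrier_mat d d \<Longrightarrow> A * 1\<^sub>m d = A" "A \<in> carrier_mat d d \<Longrightarrow> 1\<^sub>m d * A = A"
  using right_mult_one_mat[of A d d] left_mult_one_mat[of A d d] by auto

lemma unitary_cancel:
  assumes "unitary d U" "X \<in> carrier_mat d d"
  shows "adj U * (U * X) = X" "U * (adj U * X) = X"
  using assms unitaryD[OF assms(1)] by (simp_all flip: mult_assoc_square[of _ d])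

lemma eq_mat_square:
  assumes "A \<in> carrier_mat d d" "B \<in> carrier_mat d d" "\<And>i j. i < d \<Longrightarrow> j < d \<Longrightarrow> A $$ (i,j) = B $$ (i,j)"
  shows "A = B"
  using assms by (intro eq_matI) auto

lemma mtrace_square: "A \<in> carrier_mat d d \<Longrightarrow> mtrace A = (\<Sum>i<d. A $$ (i,i))"
  by (auto simp: mtrace_def)

lemma mtrace_mult:
  assumes "A \<in> carrier_mat d d" "B \<in> carrier_mat d d"
  shows "mtrace (A * B) = (\<Sum>i<d. \<Sum>j<d. A $$ (i,j) * B $$ (j,i))"
  using assms by (simp add: mtrace_square[of _ d] mult_index[of _ d d _ d])

lemma mtrace_commute:
  assumes "A \<in> carrier_mat d d" "B \<in> carrier_mat d d"
  shows "mtrace (A * B) = mtrace (B * A)"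
  unfolding mtrace_mult[OF assms] mtrace_mult[OF assms(2,1)] by (subst sum.swap) (simp add: mult.commute)

lemma mtrace_unitary_conj:
  assumes "unitary d U" "X \<in> carrier_mat d d"
  shows "mtrace (U * X * adj U) = mtrace X"
  using assms unitary_carrier[OF assms(1)] mtrace_commute[of "U * X" d "adj U"]
  by (simp add: unitary_cancel)

lemma mtrace_adj: "A \<in> carrier_mat d d \<Longrightarrow> mtrace (adj A) = cnj (mtrace A)"
  by (simp add: mtrace_square[of _ d])

text \<open>In the two eigenbases the equation reads x_i M_ij = M_ij y_j with M = U^* T V, so M_ij
  vanishes unless x_i = y_j, and then g may be applied to both. This one fact gives independence of
  the chosen decomposition, covariance under unitaries, and commutation of powers.\<close>

lemma intertwine_diag:
  fixes x y :: "nat \<Rightarrow> real" and g :: "real \<Rightarrow> complex"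
  assumes U: "unitary d U" and V: "unitary d V" and T: "T \<in> carrier_mat d d"
    and eq: "(U * mat_diag d (\<lambda>i. of_real (x i)) * adj U) * T = T * (V * mat_diag d (\<lambda>i. of_real (y i)) * adj V)"
  shows "(U * mat_diag d (\<lambda>i. g (x i)) * adj U) * T = T * (V * mat_diag d (\<lambda>i. g (y i)) * adj V)"
proof -
  note [simp] = unitary_carrier[OF U] unitary_carrier[OF V] T mult_assoc_square[of _ d]
    unitary_cancel[OF U] unitary_cancel[OF V] unitaryD(2)[OF V] unitaryD(2)[OF U]
  define M where "M = adj U * (T * V)"
  have M [simp]: "M \<in> carrier_mat d d" by (simp add: M_def)
  have "mat_diag d (\<lambda>i. of_real (x i)) * M = adj U * (((U * mat_diag d (\<lambda>i. of_real (x i)) * adj U) * T) * V)"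
    by (simp add: M_def)
  also have "\<dots> = M * mat_diag d (\<lambda>i. of_real (y i))"
    unfolding eq by (simp add: M_def)
  finally have *: "mat_diag d (\<lambda>i. of_real (x i)) * M = M * mat_diag d (\<lambda>i. of_real (y i))" .
  have "x i = y j \<or> M $$ (i,j) = 0" if "i < d" "j < d" for i j
    using arg_cong[OF *, of "\<lambda>N. N $$ (i,j)"] that
    by (auto simp: mat_diag_mult_left[OF M] mat_diag_mult_right[OF M])
  then have "mat_diag d (\<lambda>i. g (x i)) * M = M * mat_diag d (\<lambda>i. g (y i))"
    by (intro eq_mat_square[of _ d]) (fastforce simp: mat_diag_mult_left[OF M] mat_diag_mult_right[OF M])+
  then have "U * (mat_diag d (\<lambda>i. g (x i)) * M) * adj V = U * (M * mat_diag d (\<lambda>i. g (y i))) * adj V" by simp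
  then show ?thesis by (simp add: M_def unitaryD(3)[OF V])
qed

text \<open>Complex values of g admit imaginary powers, which the interpolation arguments need on
  vertical lines.\<close>

definition mfun :: "nat \<Rightarrow> (real \<Rightarrow> complex) \<Rightarrow> complex mat \<Rightarrow> complex mat" where
  "mfun d g A = (let (U, lam) = (SOME (U, lam). unitary d U \<and>
       A = U * mat_diag d (\<lambda>i. complex_of_real (lam i)) * adj U)
     in U * mat_diag d (\<lambda>i. g (lam i)) * adj U)"

lemma mat_fun_mfun: "mat_fun d f A = mfun d (\<lambda>x. of_real (f x)) A"
  by (simp add: mat_fun_def mfun_def)

text \<open>The identity intertwines any two decompositions of the same matrix, so
  \<open>intertwine_diag\<close> makes the arbitrary choice in \<open>mfun\<close>
  irrelevant.\<close>

lemma mfun_eq: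
  assumes "unitary d U" and A: "A = U * mat_diag d (\<lambda>i. complex_of_real (lam i)) * adj U"
  shows "mfun d g A = U * mat_diag d (\<lambda>i. g (lam i)) * adj U"
proof -
  define p where "p = (SOME (U, lam). unitary d U \<and> A = U * mat_diag d (\<lambda>i. complex_of_real (lam i)) * adj U)"
  obtain V y where p: "p = (V, y)" by force
  have "case p of (U, lam) \<Rightarrow> unitary d U \<and> A = U * mat_diag d (\<lambda>i. complex_of_real (lam i)) * adj U"
    unfolding p_def by (rule someI[of _ "(U, lam)"]) (use assms in auto)
  then have V: "unitary d V" "A = V * mat_diag d (\<lambda>i. complex_of_real (y i)) * adj V" by (auto simp: p)
  have "(V * mat_diag d (\<lambda>i. complex_of_real (y i)) * adj V) * 1\<^sub>m d = 1\<^sub>m d * (U * mat_diag d (\<lambda>i. of_real (lam i)) * adj U)"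
    using unitary_carrier[OF assms(1)] unitary_carrier[OF V(1)] A V(2) by (metis adj_carrier left_mult_one_mat
        mat_diag_dim mult_carrier_square right_mult_one_mat)
  from intertwine_diag[OF V(1) assms(1) _ this, of g]
  have "V * mat_diag d (\<lambda>i. g (y i)) * adj V = U * mat_diag d (\<lambda>i. g (lam i)) * adj U"
    using unitary_carrier[OF assms(1)] unitary_carrier[OF V(1)] by (simp add: left_mult_one_mat[of _ d d] right_mult_one_mat[of _ d d])
  then show ?thesis unfolding mfun_def p_def[symmetric] p by simp
qed

section \<open>Positive definite matrices under congruence and in an eigenbasis\<close>

lemma cinner_adj:
  assumes "G \<in> carrier_mat d d" "v \<in> carrier_vec d" "w \<in> carrier_vec d"
  shows "cinner v (adj G *\<^sub>v w) = cinner (G *\<^sub>v v) w"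
proof -
  have "cinner v (adj G *\<^sub>v w) = (\<Sum>i<d. \<Sum>k<d. cnj (v $ i) * (cnj (G $$ (k,i)) * w $ k))"
    using assms by (auto simp: cinner_def scalar_prod_def sum_distrib_left atLeast0LessThan adj_def)
  also have "\<dots> = (\<Sum>k<d. \<Sum>i<d. cnj (v $ i) * (cnj (G $$ (k,i)) * w $ k))" by (rule sum.swap)
  also have "\<dots> = cinner (G *\<^sub>v v) w"
    using assms by (auto simp: cinner_def scalar_prod_def sum_distrib_left sum_distrib_right atLeast0LessThan mult_ac)
  finally show ?thesis .
qed

text \<open>The left inverse G' certifies that G v is nonzero for nonzero v.\<close>

lemma pos_def_congruence:
  assumes A: "pos_def d A" and G: "G \<in> carrier_mat d d" "G' \<in> carrier_mat d d" "G' * G = 1\<^sub>m d"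
  shows "pos_def d (adj G * A * G)"
proof -
  have AC: "A \<in> carrier_mat d d" "adj A = A" using A by (auto simp: pos_def_def)
  have "Re (cinner v ((adj G * A * G) *\<^sub>v v)) > 0" if v: "v \<in> carrier_vec d" "v \<noteq> 0\<^sub>v d" for v
  proof -
    have Gv: "G *\<^sub>v v \<in> carrier_vec d" using G v by (auto intro: mult_mat_vec_carrier)
    have "G' *\<^sub>v (G *\<^sub>v v) = v" using G v by (metis assoc_mult_mat_vec one_mult_mat_vec)
    moreover have "G' *\<^sub>v 0\<^sub>v d = 0\<^sub>v d" using G(2) by (intro eq_vecI) auto
    ultimately have "G *\<^sub>v v \<noteq> 0\<^sub>v d" using v by auto
    then have "Re (cinner (G *\<^sub>v v) (A *\<^sub>v (G *\<^sub>v v))) > 0" using A Gv by (simp add: pos_def_def)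
    moreover have "(adj G * A * G) *\<^sub>v v = adj G *\<^sub>v (A *\<^sub>v (G *\<^sub>v v))"
      using AC G v by (simp add: mult_assoc_square[of _ d] assoc_mult_mat_vec[of _ d d _ d])
    ultimately show ?thesis using cinner_adj[of G d v] AC G v by (simp add: mult_mat_vec_carrier[of _ d d])
  qed
  then show ?thesis using AC G by (simp add: pos_def_def adj_mult[of _ d d _ d] mult_assoc_square[of _ d])
qed

lemma pos_def_mat_diag:
  assumes "\<And>i. i < d \<Longrightarrow> lam i > 0"
  shows "pos_def d (mat_diag d (\<lambda>i. complex_of_real (lam i)))"
proof -
  have "Re (cinner v (mat_diag d (\<lambda>i. complex_of_real (lam i)) *\<^sub>v v)) > 0"
    if v: "v \<in> carrier_vec d" "v \<noteq> 0\<^sub>v d" for v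
  proof -
    obtain i0 where "i0 < d" "v $ i0 \<noteq> 0" using v by (metis eq_vecI carrier_vecD index_zero_vec)
    then have "(\<Sum>i<d. lam i * (cmod (v $ i))\<^sup>2) > 0"
      using assms by (intro sum_pos2[of _ i0]) (auto intro!: mult_nonneg_nonneg intro: less_imp_le)
    moreover have "(mat_diag d (\<lambda>i. complex_of_real (lam i)) *\<^sub>v v) $ i = lam i * v $ i" if "i < d" for i
    proof -
      have "(mat_diag d (\<lambda>i. complex_of_real (lam i)) *\<^sub>v v) $ i = (\<Sum>k<d. (if i = k then lam k else 0) * v $ k)"
        using that v(1) by (auto simp: mat_diag_def scalar_prod_def atLeast0LessThan intro!: sum.cong)
      also have "\<dots> = (\<Sum>k<d. if i = k then lam k * v $ k else 0)" by (rule sum.cong) auto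
      finally show ?thesis using that by simp
    qed
    ultimately show ?thesis using v(1) unfolding cmod_power2
      by (simp add: cinner_def cmod_power2 algebra_simps power2_eq_square sum.distrib)
  qed
  then show ?thesis by (simp add: pos_def_def adj_mat_diag)
qed

lemma pos_def_conj_diag:
  assumes "unitary d U" "\<And>i. i < d \<Longrightarrow> lam i > 0"
  shows "pos_def d (U * mat_diag d (\<lambda>i. complex_of_real (lam i)) * adj U)"
  using pos_def_congruence[OF pos_def_mat_diag[OF assms(2)], where G = "adj U" and G' = U]
    unitary_carrier[OF assms(1)] unitaryD[OF assms(1)] by simp

lemma adj_mult_diag_index:
  assumes "U \<in> carrier_mat d d" "A \<in> carrier_mat d d" "i < d"
  shows "(adj U * A * U) $$ (i,i) = cinner (col U i) (A *\<^sub>v col U i)"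
  using assms by (simp add: mult_assoc_square[of _ d] mult_index[of _ d d _ d] cinner_def scalar_prod_def atLeast0LessThan)

lemma pos_def_spectral:
  assumes "pos_def d A"
  obtains U lam where "unitary d U" "A = U * mat_diag d (\<lambda>i. complex_of_real (lam i)) * adj U" "\<And>i. lam i > 0"
proof -
  have AC: "A \<in> carrier_mat d d" "adj A = A" using assms by (auto simp: pos_def_def)
  from spectral_decomposition[OF this] obtain U lam where U: "unitary d U"
    and A: "A = U * mat_diag d (\<lambda>i. complex_of_real (lam i)) * adj U" by blast
  note [simp] = unitary_carrier[OF U]
  have pos: "lam i > 0" if "i < d" for i
  proof -
    have "adj U * A * U = mat_diag d (\<lambda>i. complex_of_real (lam i))"
      unfolding A by (simp add: mult_assoc_square[of _ d] unitary_cancel[OF U] unitaryD[OF U])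
    then have l: "cinner (col U i) (A *\<^sub>v col U i) = lam i"
      using adj_mult_diag_index[of U d A i] that AC by (simp add: mat_diag_def)
    have "cinner (col U i) (col U i) = (adj U * U) $$ (i,i)"
      using that carrier_matD[OF unitary_carrier[OF U]]
      by (auto simp: mult_index[of _ d d _ d] cinner_def adj_index[of U d d])
    then have "cinner (col U i) (col U i) = 1" using that unitaryD[OF U] by simp
    moreover have "cinner (0\<^sub>v d) (0\<^sub>v d) = 0" by (simp add: cinner_def)
    ultimately have "col U i \<noteq> 0\<^sub>v d" by auto
    then show ?thesis using assms l that unfolding pos_def_def by (metis Re_complex_of_real col_carrier_vec \<open>U \<in> carrier_mat d d\<close> carrier_matD)
  qed
  show thesis
  \<comment> \<open>Entries beyond the dimension are set to 1, so positivity holds for every index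
    and later uses carry no bound on i.\<close>
  proof (rule that[OF U, of "\<lambda>i. if i < d then lam i else 1"])
    have "mat_diag d (\<lambda>i. complex_of_real (lam i)) = mat_diag d (\<lambda>i. complex_of_real (if i < d then lam i else 1))"
      by (auto simp: mat_diag_def)
    then show "A = U * mat_diag d (\<lambda>i. complex_of_real (if i < d then lam i else 1)) * adj U" using A by simp
  qed (use pos in auto)
qed

section \<open>Complex powers and the Hilbert-Schmidt norm\<close>

lemma of_real_cmod_square: "(complex_of_real (cmod z))\<^sup>2 = z * cnj z"
  by (metis complex_norm_square of_real_power)

text \<open>The power A^z = exp(z log A) of a positive definite matrix; in this form every entry is
  a finite sum of exponentials and hence entire in z.\<close>

definition mpow :: "nat \<Rightarrow> complex mat \<Rightarrow> complex \<Rightarrow> complex mat" where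
  "mpow d A z = mfun d (\<lambda>x. exp (z * of_real (ln x))) A"

lemma exp_ln_powr: "x > 0 \<Longrightarrow> exp (complex_of_real s * of_real (ln x)) = of_real (x powr s)"
  by (simp add: powr_def exp_of_real flip: of_real_mult)

lemma mpow_eq:
  assumes "unitary d U" "A = U * mat_diag d (\<lambda>i. complex_of_real (lam i)) * adj U"
  shows "mpow d A z = U * mat_diag d (\<lambda>i. exp (z * of_real (ln (lam i)))) * adj U"
  unfolding mpow_def by (rule mfun_eq[OF assms])

lemma mpow_of_real_eq:
  assumes "unitary d U" "A = U * mat_diag d (\<lambda>i. complex_of_real (lam i)) * adj U" "\<And>i. lam i > 0"
  shows "mpow d A (of_real s) = U * mat_diag d (\<lambda>i. of_real (lam i powr s)) * adj U"
  unfolding mpow_eq[OF assms(1,2)] using assms(3) by (simp add: exp_ln_powr)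

lemma pos_def_carrier [simp]: "pos_def d A \<Longrightarrow> A \<in> carrier_mat d d"
  by (simp add: pos_def_def)

lemma pos_def_adj: "pos_def d A \<Longrightarrow> adj A = A"
  by (simp add: pos_def_def)

lemma mpow_carrier [simp]:
  assumes "pos_def d A" shows "mpow d A z \<in> carrier_mat d d"
  using pos_def_spectral[OF assms] by (metis mpow_eq adj_carrier mat_diag_dim mult_carrier_square unitary_carrier)

lemma mpow_add:
  assumes "pos_def d A" shows "mpow d A z * mpow d A w = mpow d A (z + w)"
proof -
  from pos_def_spectral[OF assms] obtain U lam where U: "unitary d U"
    and A: "A = U * mat_diag d (\<lambda>i. complex_of_real (lam i)) * adj U" by metis
  have "mat_diag d (\<lambda>i. exp (z * of_real (ln (lam i)))) * (mat_diag d (\<lambda>i. exp (w * of_real (ln (lam i)))) * adj U)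
    = mat_diag d (\<lambda>i. exp ((z + w) * of_real (ln (lam i)))) * adj U"
    using unitary_carrier[OF U] by (simp add: distrib_right exp_add flip: mult_assoc_square[of _ d])
  then show ?thesis using unitary_carrier[OF U]
    by (simp add: mpow_eq[OF U A] mult_assoc_square[of _ d] unitary_cancel[OF U])
qed

lemma mpow_add_left:
  assumes "pos_def d A" "X \<in> carrier_mat d d"
  shows "mpow d A z * (mpow d A w * X) = mpow d A (z + w) * X"
  using assms by (simp flip: mpow_add mult_assoc_square[of _ d])

lemma mpow_0 [simp]:
  assumes "pos_def d A" shows "mpow d A 0 = 1\<^sub>m d"
proof -
  from pos_def_spectral[OF assms] obtain U lam where U: "unitary d U"
    and A: "A = U * mat_diag d (\<lambda>i. complex_of_real (lam i)) * adj U" by metis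
  show ?thesis using unitary_carrier[OF U] by (simp add: mpow_eq[OF U A] unitaryD[OF U])
qed

lemma mpow_1 [simp]:
  assumes "pos_def d A" shows "mpow d A 1 = A"
proof -
  from pos_def_spectral[OF assms] obtain U lam where U: "unitary d U"
    and A: "A = U * mat_diag d (\<lambda>i. complex_of_real (lam i)) * adj U" and p: "\<And>i. lam i > 0" by metis
  have "lam i powr 1 = lam i" for i using p[of i] by simp
  then show ?thesis using mpow_of_real_eq[OF U A p, of 1] A by simp
qed

lemma adj_mpow:
  assumes "pos_def d A" shows "adj (mpow d A z) = mpow d A (cnj z)"
proof -
  from pos_def_spectral[OF assms] obtain U lam where U: "unitary d U"
    and A: "A = U * mat_diag d (\<lambda>i. complex_of_real (lam i)) * adj U" by metis
  show ?thesis using unitary_carrier[OF U]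
    by (simp add: mpow_eq[OF U A] adj_mult[of _ d d _ d] adj_mat_diag exp_cnj mult_assoc_square[of _ d])
qed

lemma mpow_unitary:
  assumes "pos_def d A" "Re z = 0" shows "unitary d (mpow d A z)"
proof -
  have "cnj z + z = 0" using assms by (simp add: complex_eq_iff)
  then show ?thesis using assms by (simp add: unitary_def adj_mpow mpow_add)
qed

lemma mpow_pos_def:
  assumes "pos_def d A" shows "pos_def d (mpow d A (of_real s))"
proof -
  from pos_def_spectral[OF assms] obtain U lam where U: "unitary d U"
    "A = U * mat_diag d (\<lambda>i. complex_of_real (lam i)) * adj U" "\<And>i. lam i > 0" by metis
  show ?thesis unfolding mpow_of_real_eq[OF U] by (rule pos_def_conj_diag[OF U(1)]) (use U(3) in \<open>simp add: less_imp_neq[symmetric]\<close>)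
qed

text \<open>With a real inner exponent A^s is again positive definite, and its logarithm is s log
  A.\<close>

lemma mpow_mpow:
  assumes "pos_def d A" shows "mpow d (mpow d A (of_real s)) z = mpow d A (of_real s * z)"
proof -
  from pos_def_spectral[OF assms] obtain U lam where U: "unitary d U"
    "A = U * mat_diag d (\<lambda>i. complex_of_real (lam i)) * adj U" "\<And>i. lam i > 0" by metis
  have "lam i \<noteq> 0" for i using U(3)[of i] by simp
  then have "mpow d (mpow d A (of_real s)) z = U * mat_diag d (\<lambda>i. exp (of_real s * z * of_real (ln (lam i)))) * adj U"
    by (subst mpow_eq[OF U(1) mpow_of_real_eq[OF U]]) (simp add: ln_powr mult_ac)
  then show ?thesis by (simp only: mpow_eq[OF U(1,2)])
qed

lemma mpow_intertwine:
  assumes A: "pos_def d A" and B: "pos_def d B" and T: "T \<in> carrier_mat d d" and eq: "A * T = T * B"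
  shows "mpow d A z * T = T * mpow d B z"
proof -
  from pos_def_spectral[OF A] obtain U x where U: "unitary d U"
    "A = U * mat_diag d (\<lambda>i. complex_of_real (x i)) * adj U" by metis
  from pos_def_spectral[OF B] obtain V y where V: "unitary d V"
    "B = V * mat_diag d (\<lambda>i. complex_of_real (y i)) * adj V" by metis
  show ?thesis unfolding mpow_eq[OF U] mpow_eq[OF V]
    by (rule intertwine_diag[OF U(1) V(1) T]) (use eq U V in simp)
qed

lemma mpow_mult_inverse:
  assumes "pos_def d A" "X \<in> carrier_mat d d"
  shows "mpow d A z * (mpow d A (- z) * X) = X" "mpow d A (- z) * (mpow d A z * X) = X"
  using assms by (simp_all add: mpow_add_left)

lemma mtrace_conj_diag:
  assumes "unitary d U" shows "mtrace (U * mat_diag d g * adj U) = (\<Sum>i<d. g i)"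
  using assms by (simp add: mtrace_unitary_conj) (simp add: mtrace_square[of _ d] mat_diag_def)

section \<open>The squared Hilbert-Schmidt norm and trace inequalities\<close>

definition hs :: "complex mat \<Rightarrow> real" where
  "hs X = Re (mtrace (adj X * X))"

lemma hs_eq_sum:
  assumes "X \<in> carrier_mat d d" shows "hs X = (\<Sum>i<d. \<Sum>j<d. (cmod (X $$ (j,i)))\<^sup>2)"
proof -
  have "mtrace (adj X * X) = (\<Sum>i<d. \<Sum>j<d. of_real ((cmod (X $$ (j,i)))\<^sup>2))"
    using assms by (simp add: mtrace_mult[of _ d] of_real_cmod_square mult.commute)
  then show ?thesis by (simp add: hs_def)
qed

text \<open>The arithmetic-mean form of Cauchy-Schwarz: in the applications both norms have the same
  bound, so nothing is lost.\<close>

lemma hs_young: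
  assumes "X \<in> carrier_mat d d" "Y \<in> carrier_mat d d"
  shows "cmod (mtrace (adj X * Y)) \<le> (hs X + hs Y) / 2"
proof -
  have "cmod (mtrace (adj X * Y)) = cmod (\<Sum>i<d. \<Sum>j<d. cnj (X $$ (j,i)) * Y $$ (j,i))"
    using assms by (simp add: mtrace_mult[of _ d])
  also have "\<dots> \<le> (\<Sum>i<d. \<Sum>j<d. cmod (X $$ (j,i)) * cmod (Y $$ (j,i)))"
    by (intro sum_norm_le order_trans[OF norm_sum]) (simp add: norm_mult)
  also have "\<dots> \<le> (\<Sum>i<d. \<Sum>j<d. ((cmod (X $$ (j,i)))\<^sup>2 + (cmod (Y $$ (j,i)))\<^sup>2) / 2)"
    proof (intro sum_mono)
    fix i j
    show "cmod (X $$ (j,i)) * cmod (Y $$ (j,i)) \<le> ((cmod (X $$ (j,i)))\<^sup>2 + (cmod (Y $$ (j,i)))\<^sup>2) / 2"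
      using sum_squares_bound[of "cmod (X $$ (j,i))" "cmod (Y $$ (j,i))"] by (simp add: mult.assoc)
  qed
  also have "\<dots> = (hs X + hs Y) / 2"
    using assms by (simp add: hs_eq_sum[of _ d] sum.distrib flip: sum_divide_distrib)
  finally show ?thesis .
qed

lemma hs_unitary_left:
  assumes "unitary d U" "X \<in> carrier_mat d d" shows "hs (U * X) = hs X"
  using assms unitary_carrier[OF assms(1)]
  by (simp add: hs_def adj_mult[of _ d d _ d] mult_assoc_square[of _ d] unitary_cancel)

lemma hs_adj:
  assumes "X \<in> carrier_mat d d" shows "hs (adj X) = hs X"
  using assms mtrace_commute[of X d "adj X"] by (simp add: hs_def)

lemma hs_unitary_right:
  assumes "unitary d U" "X \<in> carrier_mat d d" shows "hs (X * U) = hs X"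
  using hs_unitary_left[OF unitary_adj[OF assms(1)], of "adj X"] assms unitary_carrier[OF assms(1)]
  by (metis adj_mult adj_carrier hs_adj mult_carrier_square)

lemma hs_eq_0:
  assumes "X \<in> carrier_mat d d" "hs X = 0" shows "X = 0\<^sub>m d d"
proof (rule eq_mat_square[of _ d])
  fix i j assume ij: "i < d" "j < d"
  have "(\<Sum>i<d. \<Sum>j<d. (cmod (X $$ (j,i)))\<^sup>2) = 0" using assms by (simp add: hs_eq_sum)
  then have "\<forall>i<d. \<forall>j<d. X $$ (j,i) = 0"
    by (simp add: sum_nonneg_eq_0_iff sum_nonneg)
  then show "X $$ (i,j) = 0\<^sub>m d d $$ (i,j)" using ij by simp
qed (use assms in auto)

text \<open>This yields the equality case of Cauchy-Schwarz: if Re tr[X^* Y] = hs X = hs Y, then X -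
  Y has norm 0.\<close>

lemma hs_minus:
  assumes "X \<in> carrier_mat d d" "Y \<in> carrier_mat d d"
  shows "hs (X - Y) = hs X + hs Y - 2 * Re (mtrace (adj X * Y))"
proof -
  have *: "(cmod (x - y))\<^sup>2 = (cmod x)\<^sup>2 + (cmod y)\<^sup>2 - 2 * Re (cnj x * y)" for x y
    unfolding cmod_power2 by (simp add: power2_eq_square algebra_simps)
  have "hs (X - Y) = (\<Sum>i<d. \<Sum>j<d. (cmod (X $$ (j,i)))\<^sup>2 + (cmod (Y $$ (j,i)))\<^sup>2 - 2 * Re (cnj (X $$ (j,i)) * Y $$ (j,i)))"
    using assms by (subst hs_eq_sum[of _ d])
      (auto simp: minus_carrier_mat * intro!: sum.cong)
  also have "\<dots> = hs X + hs Y - 2 * Re (mtrace (adj X * Y))"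
    using assms by (simp add: hs_eq_sum[of _ d] mtrace_mult[of _ d] sum.distrib sum_subtractf sum_distrib_left del: times_complex.sel)
  finally show ?thesis .
qed

text \<open>The squared overlaps D i j of the two eigenbases form a doubly stochastic matrix. The
  trace of the product is the D-weighted sum of the scalar products, so the scalar inequality can be
  summed, and the row and column sums 1 restore the two separate traces.\<close>

lemma mtrace_mult_mpow_le:
  assumes K: "pos_def d K" and H: "pos_def d H"
    and le: "\<And>k h :: real. k > 0 \<Longrightarrow> h > 0 \<Longrightarrow> k powr s * h powr t \<le> u * k powr a + w * h powr b"
  shows "Re (mtrace (mpow d K (of_real s) * mpow d H (of_real t)))
    \<le> u * Re (mtrace (mpow d K (of_real a))) + w * Re (mtrace (mpow d H (of_real b)))"
proof -
  from pos_def_spectral[OF K] obtain U k where U: "unitary d U"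
    "K = U * mat_diag d (\<lambda>i. complex_of_real (k i)) * adj U" "\<And>i. k i > 0" by metis
  from pos_def_spectral[OF H] obtain V h where V: "unitary d V"
    "H = V * mat_diag d (\<lambda>i. complex_of_real (h i)) * adj V" "\<And>i. h i > 0" by metis
  note [simp] = unitary_carrier[OF U(1)] unitary_carrier[OF V(1)]
  define M where "M = adj U * V"
  have M [simp]: "M \<in> carrier_mat d d" by (simp add: M_def)
  have uM: "unitary d M" unfolding M_def using U V by (intro unitary_mult unitary_adj)
  define D where "D i j = (cmod (M $$ (i,j)))\<^sup>2" for i j
  have row: "(\<Sum>j<d. D i j) = 1" if "i < d" for i
  proof -
    have "(M * adj M) $$ (i,i) = (\<Sum>j<d. of_real (D i j))"
      using that by (simp add: mult_index[of _ d d _ d] D_def of_real_cmod_square adj_index[OF M])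
    then show ?thesis using that unitaryD[OF uM] by (simp flip: of_real_sum)
  qed
  have col: "(\<Sum>i<d. D i j) = 1" if "j < d" for j
  proof -
    have "(adj M * M) $$ (j,j) = (\<Sum>i<d. of_real (D i j))"
      using that by (simp add: mult_index[of _ d d _ d] D_def of_real_cmod_square adj_index[OF M] mult.commute)
    then show ?thesis using that unitaryD[OF uM] by (simp flip: of_real_sum)
  qed
  have "mtrace (mpow d K (of_real s) * mpow d H (of_real t))
    = mtrace (U * (mat_diag d (\<lambda>i. of_real (k i powr s)) * (M * (mat_diag d (\<lambda>i. of_real (h i powr t)) * adj V))))"
    by (simp add: mpow_of_real_eq[OF U] mpow_of_real_eq[OF V] M_def mult_assoc_square[of _ d])
  also have "\<dots> = mtrace ((mat_diag d (\<lambda>i. of_real (k i powr s)) * M) * (mat_diag d (\<lambda>i. of_real (h i powr t)) * adj M))"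
    by (subst mtrace_commute[of _ d]) (simp_all add: M_def mult_assoc_square[of _ d] adj_mult[of _ d d _ d])
  also have "\<dots> = (\<Sum>i<d. \<Sum>j<d. of_real (k i powr s * h j powr t * D i j))"
    by (subst mtrace_mult[of _ d])
      (auto simp: mat_diag_mult_left[of _ d d] D_def of_real_cmod_square adj_index[OF M] mult_ac intro!: sum.cong)
  finally have "Re (mtrace (mpow d K (of_real s) * mpow d H (of_real t)))
    = (\<Sum>i<d. \<Sum>j<d. k i powr s * h j powr t * D i j)" by simp
  also have "\<dots> \<le> (\<Sum>i<d. \<Sum>j<d. (u * k i powr a + w * h j powr b) * D i j)"
    using le U(3) V(3) by (intro sum_mono mult_right_mono) (auto simp: D_def)
  also have "\<dots> = (\<Sum>i<d. u * k i powr a * (\<Sum>j<d. D i j)) + (\<Sum>j<d. w * h j powr b * (\<Sum>i<d. D i j))"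
    by (simp add: distrib_right sum.distrib sum_distrib_left) (rule sum.swap)
  also have "\<dots> = u * Re (mtrace (mpow d K (of_real a))) + w * Re (mtrace (mpow d H (of_real b)))"
    by (simp add: row col mpow_of_real_eq[OF U] mpow_of_real_eq[OF V] mtrace_conj_diag[OF U(1)] mtrace_conj_diag[OF V(1)] sum_distrib_left)
  finally show ?thesis .
qed

section \<open>The three lines theorem\<close>

text \<open>Holomorphy is asked on the whole plane: the functions in question are built from
  exponentials, and for an entire function constancy inside the strip reaches the boundary
  lines.\<close>

definition strip_bounded :: "(complex \<Rightarrow> complex) \<Rightarrow> bool" where
  "strip_bounded f \<longleftrightarrow> f holomorphic_on UNIV \<and> (\<exists>B. \<forall>z. 0 \<le> Re z \<and> Re z \<le> 1 \<longrightarrow> cmod (f z) \<le> B)"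

lemma strip_bounded_const: "strip_bounded (\<lambda>z. c)"
  by (auto simp: strip_bounded_def)

lemma strip_bounded_add:
  assumes "strip_bounded f" "strip_bounded g" shows "strip_bounded (\<lambda>z. f z + g z)"
proof -
  from assms obtain B C where "\<forall>z. 0 \<le> Re z \<and> Re z \<le> 1 \<longrightarrow> cmod (f z) \<le> B"
    "\<forall>z. 0 \<le> Re z \<and> Re z \<le> 1 \<longrightarrow> cmod (g z) \<le> C" by (auto simp: strip_bounded_def)
  then have "\<forall>z. 0 \<le> Re z \<and> Re z \<le> 1 \<longrightarrow> cmod (f z + g z) \<le> B + C" by (meson add_mono norm_triangle_le)
  then show ?thesis using assms by (auto simp: strip_bounded_def intro: holomorphic_on_add)
qed

lemma strip_bounded_mult:
  assumes "strip_bounded f" "strip_bounded g" shows "strip_bounded (\<lambda>z. f z * g z)"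
proof -
  from assms obtain B C where "\<forall>z. 0 \<le> Re z \<and> Re z \<le> 1 \<longrightarrow> cmod (f z) \<le> B"
    "\<forall>z. 0 \<le> Re z \<and> Re z \<le> 1 \<longrightarrow> cmod (g z) \<le> C" by (auto simp: strip_bounded_def)
  then have "\<forall>z. 0 \<le> Re z \<and> Re z \<le> 1 \<longrightarrow> cmod (f z * g z) \<le> B * C" by (metis norm_ge_zero norm_mult mult_mono')
  then show ?thesis using assms by (auto simp: strip_bounded_def intro: holomorphic_on_mult)
qed

lemma strip_bounded_sum: "(\<And>i. i \<in> I \<Longrightarrow> strip_bounded (f i)) \<Longrightarrow> strip_bounded (\<lambda>z. \<Sum>i\<in>I. f i z)"
  by (induction I rule: infinite_finite_induct) (auto intro: strip_bounded_const strip_bounded_add)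

lemma strip_bounded_exp: "strip_bounded (\<lambda>z. exp ((of_real a * z + of_real b) * of_real c))"
proof -
  have "cmod (exp ((of_real a * z + of_real b) * of_real c)) \<le> exp ((\<bar>a\<bar> + \<bar>b\<bar>) * \<bar>c\<bar>)" if "0 \<le> Re z" "Re z \<le> 1" for z
  proof -
    have "(a * Re z + b) * c \<le> \<bar>a * Re z + b\<bar> * \<bar>c\<bar>" by (metis abs_ge_self abs_mult)
    also have "\<dots> \<le> (\<bar>a\<bar> + \<bar>b\<bar>) * \<bar>c\<bar>"
    proof (rule mult_right_mono)
      have "\<bar>a * Re z\<bar> \<le> \<bar>a\<bar>" using that by (simp add: abs_mult mult_left_le)
      then show "\<bar>a * Re z + b\<bar> \<le> \<bar>a\<bar> + \<bar>b\<bar>" by linarith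
    qed simp
    finally show ?thesis by simp
  qed
  then show ?thesis unfolding strip_bounded_def by (intro conjI exI) (auto intro!: holomorphic_intros)
qed

text \<open>Damping by exp(e (w^2 - 1)) makes f small at great height, so the maximum modulus
  principle applies on a tall rectangle; then e tends to 0. The -1 makes the damping factor at most
  1 in modulus on the strip.\<close>

lemma three_lines_pos:
  assumes f: "strip_bounded f" and T: "T > 0"
    and bd: "\<And>z. Re z = 0 \<or> Re z = 1 \<Longrightarrow> cmod (f z) \<le> T" and z: "0 \<le> Re z" "Re z \<le> 1"
  shows "cmod (f z) \<le> T"
proof -
  obtain B where B: "\<And>z. 0 \<le> Re z \<Longrightarrow> Re z \<le> 1 \<Longrightarrow> cmod (f z) \<le> B" and hol: "f holomorphic_on UNIV"
    using f by (auto simp: strip_bounded_def)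
  have *: "cmod (f z) * exp (e * ((Re z)\<^sup>2 - (Im z)\<^sup>2 - 1)) \<le> T" if e: "e > 0" for e :: real
  proof -
    define g where "g w = f w * exp (of_real e * (w * w - 1))" for w
    have ng: "cmod (g w) = cmod (f w) * exp (e * ((Re w)\<^sup>2 - (Im w)\<^sup>2 - 1))" for w
      by (simp add: g_def norm_mult power2_eq_square)
    \<comment> \<open>The first summand puts z inside the rectangle, the second gives Y \<le> Y^2,
      and the third gives |B| \<le> T e Y, hence |B| \<le> T exp(e Y^2). The division is where T > 0
      enters.\<close>
    define Y where "Y = \<bar>Im z\<bar> + 1 + \<bar>B\<bar> / (T * e)"
    have Y: "Y > \<bar>Im z\<bar>" "Y \<ge> 1" "Y \<ge> \<bar>B\<bar> / (T * e)" using T e by (auto simp: Y_def add_strict_increasing)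
    have "\<bar>B\<bar> \<le> T * (e * Y)" using Y(3) T e by (simp add: pos_divide_le_eq mult_ac)
    also have "\<dots> \<le> T * (e * Y\<^sup>2)" using Y(2) T e by (simp add: power2_eq_square)
    also have "\<dots> \<le> T * exp (e * Y\<^sup>2)" using T exp_ge_add_one_self[of "e * Y\<^sup>2"] by (intro mult_left_mono) linarith+
    finally have "\<bar>B\<bar> * exp (- e * Y\<^sup>2) \<le> T" by (simp add: exp_minus field_simps)
    moreover have "B * exp (- e * Y\<^sup>2) \<le> \<bar>B\<bar> * exp (- e * Y\<^sup>2)" by (intro mult_right_mono) auto
    ultimately have BY: "B * exp (- e * Y\<^sup>2) \<le> T" by linarith
    define S where "S = cbox (Complex 0 (- Y)) (Complex 1 Y)"
    have "cmod (g z) \<le> T"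
    proof (rule maximum_modulus_frontier[where f = g and S = S and \<xi> = z])
      have holg: "g holomorphic_on UNIV" unfolding g_def using hol by (intro holomorphic_intros)
      then show "g holomorphic_on interior S" "continuous_on (closure S) g"
        by (auto intro: holomorphic_on_subset holomorphic_on_imp_continuous_on continuous_on_subset)
      show "bounded S" by (simp add: S_def bounded_cbox)
      show "z \<in> S" using z Y by (auto simp: S_def in_cbox_complex_iff)
      fix w assume "w \<in> frontier S"
      then have w: "w \<in> cbox (Complex 0 (- Y)) (Complex 1 Y)" "w \<notin> box (Complex 0 (- Y)) (Complex 1 Y)"
        by (auto simp: S_def frontier_cbox)
      then have r: "0 \<le> Re w" "Re w \<le> 1" by (auto simp: in_cbox_complex_iff)
      have r2: "(Re w)\<^sup>2 \<le> 1" using r by (simp add: power_le_one)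
      show "cmod (g w) \<le> T"
      proof (cases "Re w = 0 \<or> Re w = 1")
        case True
        have "e * ((Re w)\<^sup>2 - (Im w)\<^sup>2 - 1) \<le> 0" using e r2
zero_le_power2[of "Im w"]
          by (intro mult_nonneg_nonpos) linarith+
        then have "cmod (f w) * exp (e * ((Re w)\<^sup>2 - (Im w)\<^sup>2 - 1)) \<le> T * 1"
          using bd[OF True] T by (intro mult_mono) auto
        then show ?thesis by (simp add: ng)
      next
        case False
        then have "\<bar>Im w\<bar> = Y" using w Y by (auto simp: in_cbox_complex_iff in_box_complex_iff)
        then have "(Im w)\<^sup>2 = Y\<^sup>2" by (metis power2_abs)
        then have "e * ((Re w)\<^sup>2 - (Im w)\<^sup>2 - 1) \<le> - e * Y\<^sup>2" using e r2
          by (simp add: algebra_simps)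
        then have "cmod (f w) * exp (e * ((Re w)\<^sup>2 - (Im w)\<^sup>2 - 1)) \<le> B * exp (- e * Y\<^sup>2)"
          using B[OF r] order_trans[OF norm_ge_zero B[OF r]] by (intro mult_mono) auto
        then show ?thesis using BY by (simp add: ng)
      qed
    qed
    then show ?thesis by (simp add: ng)
  qed
  have "((\<lambda>e. cmod (f z) * exp (e * ((Re z)\<^sup>2 - (Im z)\<^sup>2 - 1))) \<longlongrightarrow> cmod (f z) * exp (0 * ((Re z)\<^sup>2 - (Im z)\<^sup>2 - 1))) (at_right 0)"
    by (intro tendsto_intros)
  then have "cmod (f z) * exp (0 * ((Re z)\<^sup>2 - (Im z)\<^sup>2 - 1)) \<le> T"
    by (rule tendsto_upperbound) (use * in \<open>auto simp: eventually_at_right_field intro: exI[of _ 1]\<close>)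
  then show ?thesis by simp
qed

text \<open>The case T = 0 is reached by applying the positive case to T + e.\<close>

lemma three_lines:
  assumes f: "strip_bounded f" and bd: "\<And>z. Re z = 0 \<or> Re z = 1 \<Longrightarrow> cmod (f z) \<le> T"
    and z: "0 \<le> Re z" "Re z \<le> 1"
  shows "cmod (f z) \<le> T"
proof (rule field_le_epsilon)
  fix e :: real assume "e > 0"
  have "T \<ge> 0" using bd[of 0] norm_ge_zero order_trans by (metis zero_complex.sel(1))
  then have "T + e > 0" using \<open>e > 0\<close> by simp
  moreover have "cmod (f w) \<le> T + e" if "Re w = 0 \<or> Re w = 1" for w
    using bd[OF that] \<open>e > 0\<close> by simp
  ultimately show "cmod (f z) \<le> T + e" using z by (rule three_lines_pos[OF f])
qed

text \<open>Attaining the bound at an interior point is an interior maximum of the modulus, so f is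
  constant. The conclusion is for all z; the use is at the boundary point 0.\<close>

lemma three_lines_constant:
  assumes f: "strip_bounded f" and bd: "\<And>z. Re z = 0 \<or> Re z = 1 \<Longrightarrow> cmod (f z) \<le> T"
    and w: "0 < Re w" "Re w < 1" "f w = of_real T"
  shows "f z = of_real T"
proof -
  define S where "S = {z. 0 < Re z} \<inter> {z. Re z < 1}"
  have T: "T \<ge> 0" using bd[of 0] norm_ge_zero order_trans by (metis zero_complex.sel(1))
  have "f constant_on UNIV"
  proof (rule maximum_modulus_principle[where U = S and \<xi> = w])
    show "f holomorphic_on UNIV" using f by (simp add: strip_bounded_def)
    show "open S" unfolding S_def by (intro open_Int open_halfspace_Re_gt open_halfspace_Re_lt)
    show "w \<in> S" using w by (simp add: S_def)
    fix z assume "z \<in> S"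
    then show "cmod (f z) \<le> cmod (f w)" using three_lines[OF f bd, of z] T w(3) by (simp add: S_def)
  qed auto
  then show ?thesis using w(3) by (metis constant_on_def UNIV_I)
qed

section \<open>Holomorphic matrix families on the strip\<close>

definition mat_strip :: "nat \<Rightarrow> (complex \<Rightarrow> complex mat) \<Rightarrow> bool" where
  "mat_strip d F \<longleftrightarrow> (\<forall>z. F z \<in> carrier_mat d d) \<and> (\<forall>i<d. \<forall>j<d. strip_bounded (\<lambda>z. F z $$ (i,j)))"

lemma mat_strip_const: "A \<in> carrier_mat d d \<Longrightarrow> mat_strip d (\<lambda>z. A)"
  by (simp add: mat_strip_def strip_bounded_const)

lemma mat_strip_mult:
  assumes "mat_strip d F" "mat_strip d G" shows "mat_strip d (\<lambda>z. F z * G z)"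
proof -
  have C: "F z \<in> carrier_mat d d" "G z \<in> carrier_mat d d" for z using assms by (auto simp: mat_strip_def)
  show ?thesis using assms C
    by (auto simp: mat_strip_def mult_index[OF C] intro!: strip_bounded_sum strip_bounded_mult)
qed

lemma strip_bounded_mtrace:
  assumes "mat_strip d F" shows "strip_bounded (\<lambda>z. mtrace (F z))"
proof -
  have C: "F z \<in> carrier_mat d d" for z using assms by (auto simp: mat_strip_def)
  show ?thesis using assms by (auto simp: mtrace_square[OF C] mat_strip_def intro!: strip_bounded_sum)
qed

lemma mat_strip_mpow:
  assumes "pos_def d A" shows "mat_strip d (\<lambda>z. mpow d A (of_real a * z + of_real b))"
proof -
  from pos_def_spectral[OF assms] obtain U lam where U: "unitary d U"
    "A = U * mat_diag d (\<lambda>i. complex_of_real (lam i)) * adj U" by metis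
  show ?thesis unfolding mat_strip_def mpow_eq[OF U] using unitary_carrier[OF U(1)]
    by (auto simp: conj_diag_index intro!: strip_bounded_sum strip_bounded_mult strip_bounded_const strip_bounded_exp)
qed

section \<open>The strict Araki-Lieb-Thirring inequality for exponents at least 1/2\<close>

lemma pos_def_one: "pos_def d (1\<^sub>m d)"
  using pos_def_mat_diag[of d "\<lambda>_. 1"] by simp

lemma pos_def_gram:
  assumes "G \<in> carrier_mat d d" "G' \<in> carrier_mat d d" "G' * G = 1\<^sub>m d"
  shows "pos_def d (adj G * G)"
  using pos_def_congruence[OF pos_def_one assms] assms by simp

text \<open>As G is invertible, the unitary factor can be written down as G (G^* G)^(-1/2).\<close>

lemma polar_decomposition:
  assumes G: "G \<in> carrier_mat d d" "G' \<in> carrier_mat d d" "G' * G = 1\<^sub>m d"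
  obtains V where "unitary d V" "G = V * mpow d (adj G * G) (1/2)"
proof
  define P where "P = adj G * G"
  have P: "pos_def d P" unfolding P_def using pos_def_gram[OF G] .
  define V where "V = G * mpow d P (- (1/2))"
  have "adj V * V = mpow d P (- (1/2)) * (P * mpow d P (- (1/2)))"
    unfolding V_def using P G(1)
    by (simp add: adj_mult[of _ d d _ d] adj_mpow P_def[symmetric] mult_assoc_square[of _ d])
       (simp add: P_def mult_assoc_square[of _ d])
  also have "\<dots> = mpow d P (- (1/2)) * (mpow d P 1 * mpow d P (- (1/2)))" using P by simp
  also have "\<dots> = 1\<^sub>m d" using P by (simp only: mpow_add) simp
  finally show "unitary d V" using P G by (simp add: unitary_def V_def)
  show "G = V * mpow d (adj G * G) (1/2)" using P G(1)
    by (simp add: V_def mult_assoc_square[of _ d] mpow_add flip: P_def)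
qed

lemma mpow_unitary_conj:
  assumes "pos_def d A" "unitary d U"
  shows "pos_def d (adj U * A * U)" and "mpow d (adj U * A * U) z = adj U * mpow d A z * U"
proof -
  note C [simp] = unitary_carrier[OF assms(2)]
  show p: "pos_def d (adj U * A * U)"
    by (rule pos_def_congruence[OF assms(1) C adj_carrier[OF C] unitaryD(2)[OF assms(2)]])
  have "mpow d A z * U = U * mpow d (adj U * A * U) z"
    by (rule mpow_intertwine[OF assms(1) p C])
      (use assms(1) in \<open>simp add: mult_assoc_square[of _ d] unitary_cancel[OF assms(2)]\<close>)
  then show "mpow d (adj U * A * U) z = adj U * mpow d A z * U"
    using assms p by (simp add: mult_assoc_square[of _ d] unitary_cancel[OF assms(2)])
qed

text \<open>The unitary is absorbed into P: with R = U^* P U the left-hand side is tr[R^s Q^t], and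
  R^a has the same trace as P^a.\<close>

lemma hs_mpow_unitary_mpow_le:
  assumes P: "pos_def d P" and Q: "pos_def d Q" and U: "unitary d U"
    and le: "\<And>k h :: real. k > 0 \<Longrightarrow> h > 0 \<Longrightarrow> k powr s * h powr t \<le> u * k powr a + w * h powr b"
  shows "hs (mpow d P (of_real (s/2)) * (U * mpow d Q (of_real (t/2))))
    \<le> u * Re (mtrace (mpow d P (of_real a))) + w * Re (mtrace (mpow d Q (of_real b)))"
proof -
  note C [simp] = unitary_carrier[OF U] mpow_carrier[OF P] mpow_carrier[OF Q]
  define R where "R = adj U * P * U"
  have R: "pos_def d R" "\<And>z. mpow d R z = adj U * mpow d P z * U"
    unfolding R_def by (rule mpow_unitary_conj[OF P U])+
  have h: "mpow d A (of_real (x/2)) * (mpow d A (of_real (x/2)) * X) = mpow d A (of_real x) * X"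
    if "pos_def d A" "X \<in> carrier_mat d d" for A X and x :: real
    using that by (simp add: mpow_add_left flip: of_real_add)
  have "hs (mpow d P (of_real (s/2)) * (U * mpow d Q (of_real (t/2))))
    = Re (mtrace (mpow d Q (of_real (t/2)) * (mpow d R (of_real s) * mpow d Q (of_real (t/2)))))"
    unfolding hs_def R by (simp add: adj_mult[of _ d d _ d] adj_mpow P Q mult_assoc_square[of _ d] h[OF P] del: of_real_divide)
  also have "\<dots> = Re (mtrace (mpow d R (of_real s) * mpow d Q (of_real t)))"
    using R(1) h[OF Q, of "1\<^sub>m d" t] by (subst mtrace_commute[of _ d]) (simp_all add: mult_assoc_square[of _ d] del: of_real_divide)
  also have "\<dots> \<le> u * Re (mtrace (mpow d R (of_real a))) + w * Re (mtrace (mpow d Q (of_real b)))"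
    by (rule mtrace_mult_mpow_le[OF R(1) Q le])
  also have "mtrace (mpow d R (of_real a)) = mtrace (mpow d P (of_real a))"
    unfolding R using mtrace_unitary_conj[OF unitary_adj[OF U], of "mpow d P (of_real a)"] by simp
  finally show ?thesis .
qed

lemma cmod_mtrace_mult_le:
  assumes "X \<in> carrier_mat d d" "Y \<in> carrier_mat d d"
  shows "cmod (mtrace (X * Y)) \<le> (hs X + hs Y) / 2"
  using hs_young[of "adj X" d Y] assms by (simp add: hs_adj)

text \<open>Halving both powers writes the trace as tr[X Y^*] with one unitary in each factor; both
  norms then obey the same bound by \<open>hs_mpow_unitary_mpow_le\<close>.\<close>

lemma mtrace_mpow_unitary_le:
  assumes P: "pos_def d P" and Q: "pos_def d Q" and U: "unitary d U" and V: "unitary d V"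
    and le: "\<And>k h :: real. k > 0 \<Longrightarrow> h > 0 \<Longrightarrow> k powr s * h powr t \<le> u * k powr a + w * h powr b"
  shows "cmod (mtrace (mpow d P (of_real s) * (U * (mpow d Q (of_real t) * V))))
    \<le> u * Re (mtrace (mpow d P (of_real a))) + w * Re (mtrace (mpow d Q (of_real b)))"
proof -
  note C [simp] = unitary_carrier[OF U] unitary_carrier[OF V] mpow_carrier[OF P] mpow_carrier[OF Q]
  have h: "mpow d A (of_real (x/2)) * (mpow d A (of_real (x/2)) * X) = mpow d A (of_real x) * X"
    if "pos_def d A" "X \<in> carrier_mat d d" for A X and x :: real
    using that by (simp add: mpow_add_left flip: of_real_add)
  define M where "M = u * Re (mtrace (mpow d P (of_real a))) + w * Re (mtrace (mpow d Q (of_real b)))"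
  define X where "X = mpow d P (of_real (s/2)) * (U * mpow d Q (of_real (t/2)))"
  define Y where "Y = mpow d P (of_real (s/2)) * (adj V * mpow d Q (of_real (t/2)))"
  have XY [simp]: "X \<in> carrier_mat d d" "Y \<in> carrier_mat d d" by (simp_all add: X_def Y_def)
  have "mtrace (X * adj Y) = mtrace ((mpow d P (of_real (s/2)) * (U * (mpow d Q (of_real t) * V))) * mpow d P (of_real (s/2)))"
    unfolding X_def Y_def
    by (simp add: adj_mult[of _ d d _ d] adj_mpow P Q mult_assoc_square[of _ d] h[OF Q] del: of_real_divide)
  also have "\<dots> = mtrace (mpow d P (of_real s) * (U * (mpow d Q (of_real t) * V)))"
    by (subst mtrace_commute[of _ d]) (simp_all add: h[OF P] del: of_real_divide)
  finally have "cmod (mtrace (mpow d P (of_real s) * (U * (mpow d Q (of_real t) * V)))) \<le> (hs X + hs Y) / 2"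
    using cmod_mtrace_mult_le[of X d "adj Y"] by (simp add: hs_adj[of _ d])
  also have "\<dots> \<le> (M + M) / 2"
    unfolding X_def Y_def M_def
    by (intro divide_right_mono add_mono hs_mpow_unitary_mpow_le[OF P Q _ le] U unitary_adj[OF V]) simp_all
  finally show ?thesis by (simp add: M_def)
qed

text \<open>A and B are themselves powers of A^s and B^t, with exponents 1/s and 1/t, so commutation
  descends to them.\<close>

lemma commute_mpow:
  assumes A: "pos_def d A" and B: "pos_def d B" and "s \<noteq> 0" "t \<noteq> 0"
    and eq: "mpow d A (of_real s) * mpow d B (of_real t) = mpow d B (of_real t) * mpow d A (of_real s)"
  shows "A * B = B * A"
proof -
  have root: "mpow d (mpow d E (of_real x)) (of_real (1/x)) = E" if "pos_def d E" "x \<noteq> 0" for E and x :: real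
    using that by (simp add: mpow_mpow flip: of_real_mult)
  have "A * mpow d B (of_real t) = mpow d B (of_real t) * A"
    using mpow_intertwine[OF mpow_pos_def[OF A] mpow_pos_def[OF A] mpow_carrier[OF B] eq, of "of_real (1/s)"]
    by (simp only: root[OF A \<open>s \<noteq> 0\<close>])
  then have "mpow d B (of_real t) * A = A * mpow d B (of_real t)" by simp
  then show ?thesis
    using mpow_intertwine[OF mpow_pos_def[OF B] mpow_pos_def[OF B] pos_def_carrier[OF A], of t t "of_real (1/t)"]
    by (simp only: root[OF B \<open>t \<noteq> 0\<close>])
qed

lemma hs_mpow_half:
  assumes "pos_def d P" shows "hs (mpow d P (1/2)) = Re (mtrace P)"
  using assms by (simp add: hs_def adj_mpow mpow_add)

lemma hs_minus_eq_0:
  assumes X: "X \<in> carrier_mat d d" and Y: "Y \<in> carrier_mat d d" and "hs (X - Y) = 0"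
  shows "X = Y"
proof (rule eq_mat_square[OF X Y])
  fix i j assume "i < d" "j < d"
  moreover have "X - Y = 0\<^sub>m d d" using assms by (intro hs_eq_0) (simp_all add: minus_carrier_mat)
  ultimately show "X $$ (i,j) = Y $$ (i,j)"
    using Y by (metis carrier_matD index_minus_mat(1) index_zero_mat(1) right_minus_eq)
qed

lemma sandwich_eq_gram:
  assumes "pos_def d A" "pos_def d B"
  shows "mpow d B (1/2) * A * mpow d B (1/2) = adj (mpow d A (1/2) * mpow d B (1/2)) * (mpow d A (1/2) * mpow d B (1/2))"
  using assms by (simp add: adj_mult[of _ d d _ d] adj_mpow mult_assoc_square[of _ d] mpow_add_left)

lemma mpow_mult_left_inverse:
  assumes "pos_def d A" "pos_def d B"
  shows "(mpow d B (- w) * mpow d A (- z)) * (mpow d A z * mpow d B w) = 1\<^sub>m d"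
  using assms by (simp add: mult_assoc_square[of _ d] mpow_mult_inverse mpow_add)

text \<open>Hadamard's three lines theorem for
  F(z) = tr[K^(1-z/r) G_r^* A^(z/2) B^(z/2)], where G_r = A^(r/2) B^(r/2) has polar decomposition VK.
  If the inequality failed, |F| would attain its maximum over the strip at r, so F(0) = F(r) and V = 1;
  then G_r is Hermitian.\<close>

lemma araki_lieb_thirring_strict_half:
  assumes A: "pos_def d A" and B: "pos_def d B" and nc: "A * B \<noteq> B * A" and r: "1/2 \<le> r" "r < 1"
  shows "Re (mtrace (mpow d A (of_real r) * mpow d B (of_real r)))
    < Re (mtrace (mpow d (mpow d B (1/2) * A * mpow d B (1/2)) (of_real r)))"
proof (rule ccontr)
  define T where "T = Re (mtrace (mpow d A (of_real r) * mpow d B (of_real r)))"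
  define Q where "Q = mpow d B (1/2) * A * mpow d B (1/2)"
  define R where "R = Re (mtrace (mpow d Q (of_real r)))"
  assume "\<not> ?thesis"
  then have RT: "R \<le> T" by (simp add: T_def Q_def R_def)
  define G where "G = mpow d A (of_real (r/2)) * mpow d B (of_real (r/2))"
  define P where "P = adj G * G"
  note C [simp] = mpow_carrier[OF A] mpow_carrier[OF B]
  have GC [simp]: "G \<in> carrier_mat d d" by (simp add: G_def)
  have G': "(mpow d B (- of_real (r/2)) * mpow d A (- of_real (r/2))) * G = 1\<^sub>m d"
    unfolding G_def by (rule mpow_mult_left_inverse[OF A B])
  have P: "pos_def d P" unfolding P_def by (rule pos_def_gram[OF GC _ G']) simp
  obtain V where V: "unitary d V" "G = V * mpow d P (1/2)"
    using polar_decomposition[OF GC _ G'] unfolding P_def by (metis C mult_carrier_square)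
  note VC [simp] = unitary_carrier[OF V(1)] and PC [simp] = mpow_carrier[OF P] pos_def_carrier[OF P]
  have aG: "adj G = mpow d P (1/2) * adj V"
    by (subst V(2)) (simp add: adj_mult[of _ d d _ d] adj_mpow[OF P])
  have hh: "mpow d E (of_real (r/2)) * mpow d E (of_real (r/2)) = mpow d E (of_real r)" if "pos_def d E" for E
    using that by (simp add: mpow_add flip: of_real_add)
  have trP: "mtrace P = mtrace (mpow d A (of_real r) * mpow d B (of_real r))"
  proof -
    have "P = mpow d B (of_real (r/2)) * (mpow d A (of_real r) * mpow d B (of_real (r/2)))"
      unfolding P_def G_def hh[OF A, symmetric]
      by (simp add: adj_mult[of _ d d _ d] adj_mpow A B mult_assoc_square[of _ d])
    then have "mtrace P = mtrace ((mpow d A (of_real r) * mpow d B (of_real (r/2))) * mpow d B (of_real (r/2)))"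
      by (simp add: mtrace_commute[of _ d])
    then show ?thesis by (simp add: mult_assoc_square[of _ d] hh[OF B] del: of_real_divide)
  qed
  define G1 where "G1 = mpow d A (1/2) * mpow d B (1/2)"
  have QG: "Q = adj G1 * G1" unfolding Q_def G1_def by (rule sandwich_eq_gram[OF A B])
  have G1C [simp]: "G1 \<in> carrier_mat d d" by (simp add: G1_def)
  have G1': "(mpow d B (- (1/2)) * mpow d A (- (1/2))) * G1 = 1\<^sub>m d"
    unfolding G1_def by (rule mpow_mult_left_inverse[OF A B])
  have Q: "pos_def d Q" unfolding QG by (rule pos_def_gram[OF G1C _ G1']) simp
  obtain W where W: "unitary d W" "G1 = W * mpow d Q (1/2)"
    using polar_decomposition[OF G1C _ G1'] unfolding QG by (metis C mult_carrier_square)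
  note WC [simp] = unitary_carrier[OF W(1)] and QC [simp] = mpow_carrier[OF Q]
  \<comment> \<open>The exponent of P starts at 1/2 because \<open>adj G\<close> contributes the
    other factor P^(1/2). The affine exponents with real coefficients match
    \<open>mat_strip_mpow\<close>.\<close>
  define F where "F z = mtrace (mpow d P (of_real (- 1 / (2 * r)) * z + of_real (1/2)) *
      (adj G * (mpow d A (of_real (1/2) * z + of_real 0) * mpow d B (of_real (1/2) * z + of_real 0))))" for z
  have F: "strip_bounded F" unfolding F_def
    by (intro strip_bounded_mtrace[of d] mat_strip_mult mat_strip_const mat_strip_mpow A B P adj_carrier GC)
  have F2: "F z = mtrace (mpow d P (1 - z / (2 * r)) * (adj V * (mpow d A (z/2) * mpow d B (z/2))))" for z
  proof -
    have "- 1 / (2 * r) * z + (1/2) + (1/2) = 1 - z / (2 * r)" by simp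
    then show ?thesis unfolding F_def aG
      by (simp add: mult_assoc_square[of _ d] mpow_add_left[OF P])
  qed
  have T0: "T = hs (mpow d P (1/2))" using hs_mpow_half[OF P] by (simp add: T_def trP)
  \<comment> \<open>On this line F z = tr[P Z] with Z unitary, since all other exponents are
    imaginary.\<close>
  have b0: "cmod (F z) \<le> T" if "Re z = 0" for z
  proof -
    define Z where "Z = mpow d P (- (z / (2 * r))) * (adj V * (mpow d A (z/2) * mpow d B (z/2)))"
    have Z: "unitary d Z" unfolding Z_def
      by (intro unitary_mult mpow_unitary A B P unitary_adj V) (use that in simp_all)
    have "F z = mtrace (mpow d P (1/2) * (mpow d P (1/2) * Z))"
      unfolding F2 Z_def by (simp add: mpow_add_left[OF P] unitary_carrier[OF Z])
    then show ?thesis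
      using cmod_mtrace_mult_le[of "mpow d P (1/2)" d "mpow d P (1/2) * Z"] unitary_carrier[OF Z]
      by (simp add: hs_unitary_right[OF Z] T0)
  qed
  have b1: "cmod (F z) \<le> T" if z: "Re z = 1" for z
  proof -
    \<comment> \<open>On Re z = 1 the imaginary parts of the exponents go into the unitaries U1 and
      U2, leaving P^(1-w) and Q^(1/2) = (Q^r)^w. Young's inequality needs w \<le> 1, which is r
      \<ge> 1/2; the negated claim R \<le> T then closes the bound.\<close>
    define w where "w = 1 / (2 * r)"
    define U1 where "U1 = mpow d P ((1 - z) / (2 * r)) * (adj V * (mpow d A ((z - 1) / 2) * W))"
    define U2 where "U2 = mpow d B ((z - 1) / 2)"
    have U: "unitary d U1" "unitary d U2" unfolding U1_def U2_def
      by (intro unitary_mult mpow_unitary A B P unitary_adj V W; use z in simp)+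
    have zz: "z / 2 = (z - 1) / 2 + 1/2" "z / 2 = 1/2 + (z - 1) / 2" by (simp_all add: field_simps)
    have AB: "mpow d A (z/2) * mpow d B (z/2) = mpow d A ((z - 1) / 2) * (W * (mpow d Q (1/2) * U2))"
    proof -
      have "mpow d A (z/2) * mpow d B (z/2) = (mpow d A ((z - 1) / 2) * mpow d A (1/2)) * (mpow d B (1/2) * mpow d B ((z - 1) / 2))"
        unfolding mpow_add[OF A] mpow_add[OF B] zz[symmetric] ..
      also have "\<dots> = mpow d A ((z - 1) / 2) * (G1 * U2)"
        by (simp add: G1_def U2_def mult_assoc_square[of _ d])
      also have "G1 * U2 = W * (mpow d Q (1/2) * U2)"
        by (subst W(2)) (simp add: mult_assoc_square[of _ d] U2_def)
      finally show ?thesis .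
    qed
    have pz: "1 - z / (2 * r) = of_real (1 - w) + (1 - z) / (2 * r)" using r by (simp add: w_def field_simps)
    have "F z = mtrace (mpow d P (of_real (1 - w)) * (U1 * (mpow d Q (of_real (1/2)) * U2)))"
      unfolding F2 AB pz mpow_add[OF P, symmetric] U1_def U2_def by (simp add: mult_assoc_square[of _ d])
    also have "cmod \<dots> \<le> (1 - w) * Re (mtrace (mpow d P (of_real 1))) + w * Re (mtrace (mpow d Q (of_real r)))"
    proof (rule mtrace_mpow_unitary_le[OF P Q U])
      fix k h :: real assume kh: "k > 0" "h > 0"
      have "h powr (1/2) = (h powr r) powr w" using r by (simp add: powr_powr w_def)
      then show "k powr (1 - w) * h powr (1/2) \<le> (1 - w) * k powr 1 + w * h powr r"
        using Youngs_inequality_0[of "1 - w" w k "h powr r"] kh r by (simp add: w_def)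
    qed
    also have "\<dots> = (1 - w) * T + w * R" using P by (simp add: T_def trP R_def)
    also have "\<dots> \<le> (1 - w) * T + w * T" using RT r by (intro add_left_mono mult_left_mono) (auto simp: w_def)
    finally show ?thesis by (simp add: algebra_simps)
  qed
  \<comment> \<open>At z = r the power of P is trivial and the remaining factor is G^* G =
    P.\<close>
  have Fr: "F (of_real r) = of_real T"
  proof -
    have "adj G * (mpow d A (of_real r / 2) * mpow d B (of_real r / 2)) = P" by (simp add: P_def G_def)
    then have "F (of_real r) = mtrace (mpow d P 0 * P)" using r unfolding F_def by (simp add: mult.commute)
    moreover have "Im (mtrace P) = 0"
      using mtrace_adj[of P d] pos_def_adj[OF P] by (simp add: complex_eq_iff)
    ultimately show ?thesis using P by (simp add: T_def trP[symmetric] complex_eq_iff)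
  qed
  \<comment> \<open>The bound is attained at r, which is interior because r < 1. At 0 this reads
    tr[P V^*] = tr P, equality in Cauchy-Schwarz, which removes the unitary from the polar
    decomposition.\<close>
  have "F 0 = of_real T"
    by (rule three_lines_constant[OF F _ _ _ Fr]) (use b0 b1 r in auto)
  then have "mtrace (P * adj V) = of_real T" unfolding F2 using A B P by simp
  moreover have "adj (mpow d P (1/2)) * (mpow d P (1/2) * adj V) = P * adj V"
    using P by (simp add: adj_mpow mpow_add_left)
  ultimately have "hs (mpow d P (1/2) - mpow d P (1/2) * adj V) = 0"
    by (subst hs_minus[of _ d]) (simp_all add: hs_unitary_right[OF unitary_adj[OF V(1)]] T0)
  then have "mpow d P (1/2) = mpow d P (1/2) * adj V" by (intro hs_minus_eq_0[of _ d]) simp_all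
  then have "adj G = mpow d P (1/2)" by (simp add: aG)
  then have "adj G = G" by (metis P adj_adj adj_mpow complex_cnj_divide complex_cnj_numeral complex_cnj_one)
  then have "mpow d A (of_real (r/2)) * mpow d B (of_real (r/2)) = mpow d B (of_real (r/2)) * mpow d A (of_real (r/2))"
    unfolding G_def by (simp add: adj_mult[of _ d d _ d] adj_mpow A B)
  then show False using commute_mpow[OF A B, of "r/2" "r/2"] nc r by simp
qed

section \<open>Measurements\<close>

definition diag_prob :: "complex mat \<Rightarrow> complex mat \<Rightarrow> nat \<Rightarrow> real" where
  "diag_prob Q A i = Re ((adj Q * A * Q) $$ (i,i))"

lemma cinner_col_unitary:
  assumes "unitary d U" "i < d" "j < d"
  shows "cinner (col U i) (col U j) = (if i = j then 1 else 0)"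
proof -
  have "cinner (col U i) (col U j) = (adj U * U) $$ (i,j)"
    using assms unitary_carrier[OF assms(1)] by (auto simp: mult_index[of _ d d _ d] cinner_def)
  then show ?thesis using assms unitaryD[OF assms(1)] by simp
qed

lemma diag_prob_pos:
  assumes "pos_def d A" "unitary d Q" "i < d" shows "diag_prob Q A i > 0"
proof -
  have "cinner (0\<^sub>v d) (0\<^sub>v d) = 0" by (simp add: cinner_def)
  then have "col Q i \<noteq> 0\<^sub>v d" using cinner_col_unitary[OF assms(2,3,3)] by auto
  moreover have "col Q i \<in> carrier_vec d" using unitary_carrier[OF assms(2)] assms(3) by auto
  ultimately show ?thesis using assms unitary_carrier[OF assms(2)]
    by (simp add: diag_prob_def adj_mult_diag_index[of _ d] pos_def_def)
qed

lemma Re_mtrace_mult_conj_diag: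
  assumes A: "A \<in> carrier_mat d d" and Q: "unitary d Q"
  shows "Re (mtrace (A * (Q * mat_diag d (\<lambda>i. of_real (g i)) * adj Q))) = (\<Sum>i<d. diag_prob Q A i * g i)"
proof -
  note [simp] = unitary_carrier[OF Q] A
  have "mtrace (A * (Q * mat_diag d (\<lambda>i. of_real (g i)) * adj Q))
    = mtrace ((A * (Q * mat_diag d (\<lambda>i. of_real (g i)))) * adj Q)" by (simp add: mult_assoc_square[of _ d])
  also have "\<dots> = mtrace ((adj Q * A * Q) * mat_diag d (\<lambda>i. of_real (g i)))"
    by (subst mtrace_commute[of _ d]) (simp_all add: mult_assoc_square[of _ d])
  also have "\<dots> = (\<Sum>i<d. (adj Q * A * Q) $$ (i,i) * of_real (g i))"
    by (subst mtrace_square[of _ d]) (simp_all add: mat_diag_mult_right[of _ d d])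
  finally show ?thesis by (simp add: diag_prob_def)
qed

text \<open>Since \<Omega> is diagonal in the basis Q, only the outcome probabilities of A enter,
  and the imaginary part of w drops out. This evaluates the boundary norms in
  \<open>petz_renyi_pinching\<close>.\<close>

lemma hs_half_mpow:
  assumes A: "pos_def d A" and Q: "unitary d Q" and m: "\<And>i. m i > 0"
    and O: "\<Omega> = Q * mat_diag d (\<lambda>i. complex_of_real (m i)) * adj Q"
  shows "hs (mpow d A (1/2) * mpow d \<Omega> w) = (\<Sum>i<d. diag_prob Q A i * m i powr (2 * Re w))"
    and "hs (mpow d \<Omega> w * mpow d A (1/2)) = (\<Sum>i<d. diag_prob Q A i * m i powr (2 * Re w))"
proof -
  have P: "pos_def d \<Omega>" unfolding O using pos_def_conj_diag[OF Q] m by blast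
  note [simp] = mpow_carrier[OF A] mpow_carrier[OF P] pos_def_carrier[OF A]
  have *: "hs (mpow d A (1/2) * mpow d \<Omega> w) = (\<Sum>i<d. diag_prob Q A i * m i powr (2 * Re w))" for w
  proof -
    have "hs (mpow d A (1/2) * mpow d \<Omega> w) = Re (mtrace (mpow d \<Omega> (cnj w) * (A * mpow d \<Omega> w)))"
      by (simp add: hs_def adj_mult[of _ d d _ d] adj_mpow A P mult_assoc_square[of _ d] mpow_add_left)
    also have "\<dots> = Re (mtrace (A * mpow d \<Omega> (w + cnj w)))"
      by (subst mtrace_commute[of _ d]) (simp_all add: mult_assoc_square[of _ d] mpow_add P)
    also have "w + cnj w = of_real (2 * Re w)" by (simp add: complex_eq_iff)
    finally show ?thesis unfolding mpow_of_real_eq[OF Q O m] by (simp add: Re_mtrace_mult_conj_diag[OF _ Q])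
  qed
  show "hs (mpow d A (1/2) * mpow d \<Omega> w) = (\<Sum>i<d. diag_prob Q A i * m i powr (2 * Re w))" by (rule *)
  have "hs (mpow d \<Omega> w * mpow d A (1/2)) = hs (mpow d A (1/2) * mpow d \<Omega> (cnj w))"
    by (subst hs_adj[symmetric, of _ d]) (simp_all add: adj_mult[of _ d d _ d] adj_mpow A P)
  then show "hs (mpow d \<Omega> w * mpow d A (1/2)) = (\<Sum>i<d. diag_prob Q A i * m i powr (2 * Re w))"
    using *[of "cnj w"] by simp
qed

text \<open>Three lines for F(z) = tr[A^z L(z) B^(1-z) L(z)], where L(z) is diagonal in the basis Q with entries
  (q/p)^((z-r)/2): this exponent makes the bounds on both boundary lines equal to the right-hand side.\<close>

lemma petz_renyi_pinching:
  assumes A: "pos_def d A" and B: "pos_def d B" and Q: "unitary d Q" and r: "0 < r" "r < 1"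
  shows "Re (mtrace (mpow d A (of_real r) * mpow d B (of_real (1 - r))))
    \<le> (\<Sum>i<d. diag_prob Q A i powr r * diag_prob Q B i powr (1 - r))"
proof -
  define p where "p = diag_prob Q A"
  define q where "q = diag_prob Q B"
  have pq: "p i > 0" "q i > 0" if "i < d" for i
    using that diag_prob_pos[OF A Q] diag_prob_pos[OF B Q] by (auto simp: p_def q_def)
  \<comment> \<open>A square root because the norms double the exponent:
    \<open>m i powr (2 * x)\<close> is (q/p)^x. The value 1 beyond the dimension keeps m positive
    everywhere.\<close>
  define m where "m i = (if i < d then sqrt (q i / p i) else 1)" for i
  have m: "m i > 0" for i using pq by (simp add: m_def)
  define T where "T = (\<Sum>i<d. p i powr r * q i powr (1 - r))"
  define Om where "Om = Q * mat_diag d (\<lambda>i. complex_of_real (m i)) * adj Q"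
  have P: "pos_def d Om" unfolding Om_def using pos_def_conj_diag[OF Q] m by blast
  note [simp] = mpow_carrier[OF A] mpow_carrier[OF P] mpow_carrier[OF B]
  have mm: "m i powr (2 * x) = (q i / p i) powr x" if "i < d" for i x
    using that pq[OF that] by (simp add: m_def powr_half_sqrt[symmetric] powr_powr)
  have t0: "(\<Sum>i<d. q i * m i powr (2 * (- r))) = T" unfolding T_def
  proof (rule sum.cong)
    fix i assume "i \<in> {..<d}"
    then have i: "i < d" by simp
    have "q i * (q i / p i) powr (- r) = q i powr 1 * (p i powr r * q i powr (- r))"
      using pq[OF i] by (simp add: powr_divide powr_minus field_simps)
    also have "\<dots> = p i powr r * q i powr (1 - r)" by (simp add: powr_diff powr_minus field_simps)
    finally show "q i * m i powr (2 * (- r)) = p i powr r * q i powr (1 - r)" unfolding mm[OF i] .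
  qed simp
  have t1: "(\<Sum>i<d. p i * m i powr (2 * (1 - r))) = T" unfolding T_def
  proof (rule sum.cong)
    fix i assume "i \<in> {..<d}"
    then have i: "i < d" by simp
    have "p i * (q i / p i) powr (1 - r) = p i powr (1 - (1 - r)) * q i powr (1 - r)"
      using pq[OF i] by (simp add: powr_divide powr_diff)
    then show "p i * m i powr (2 * (1 - r)) = p i powr r * q i powr (1 - r)" unfolding mm[OF i] by simp
  qed simp
  define F where "F z = mtrace (mpow d A (of_real 1 * z + of_real 0) * (mpow d Om (of_real 1 * z + of_real (- r)) *
      (mpow d B (of_real (- 1) * z + of_real 1) * mpow d Om (of_real 1 * z + of_real (- r)))))" for z
  have F: "strip_bounded F" unfolding F_def
    by (intro strip_bounded_mtrace[of d] mat_strip_mult mat_strip_mpow A B P)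
  have F2: "F z = mtrace (mpow d A z * (mpow d Om (z - r) * (mpow d B (1 - z) * mpow d Om (z - r))))" for z
    unfolding F_def by simp
  have b0: "cmod (F z) \<le> T" if "Re z = 0" for z
  proof -
    define X where "X = mpow d A z * (mpow d Om (z - r) * mpow d B (1/2))"
    define Y where "Y = mpow d B (- z) * (mpow d B (1/2) * mpow d Om (z - r))"
    have "1 - z = 1/2 + (- z + 1/2)" by simp
    then have "F z = mtrace (X * Y)" unfolding F2 X_def Y_def
      by (simp add: mult_assoc_square[of _ d] mpow_add_left[OF B])
    moreover have "hs X = T" "hs Y = T" unfolding X_def Y_def using that
      by (simp_all add: hs_unitary_left[of d] mpow_unitary A B hs_half_mpow[OF B Q m Om_def] q_def[symmetric] flip: t0)
    ultimately show ?thesis using cmod_mtrace_mult_le[of X d Y] by (simp add: X_def Y_def)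
  qed
  \<comment> \<open>Now the power of A is the one to be halved; it stands at the left end, so
    cyclicity carries one half to the right end.\<close>
  have b1: "cmod (F z) \<le> T" if "Re z = 1" for z
  proof -
    define X where "X = mpow d A (z - 1) * (mpow d A (1/2) * mpow d Om (z - r))"
    define Y where "Y = mpow d B (1 - z) * (mpow d Om (z - r) * mpow d A (1/2))"
    have XY [simp]: "X \<in> carrier_mat d d" "Y \<in> carrier_mat d d" by (simp_all add: X_def Y_def)
    have zz: "z = 1/2 + (z - 1 + 1/2)" by simp
    have "F z = mtrace (mpow d A (1/2) * (X * (mpow d B (1 - z) * mpow d Om (z - r))))"
      unfolding F2 X_def by (subst zz) (simp add: mult_assoc_square[of _ d] mpow_add_left[OF A])
    also have "\<dots> = mtrace (X * Y)"
      by (subst mtrace_commute[of _ d]) (simp_all add: Y_def mult_assoc_square[of _ d])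
    finally have "F z = mtrace (X * Y)" .
    moreover have "hs X = T" "hs Y = T" unfolding X_def Y_def using that
      by (simp_all add: hs_unitary_left[of d] mpow_unitary A B hs_half_mpow[OF A Q m Om_def] p_def[symmetric] flip: t1)
    ultimately show ?thesis using cmod_mtrace_mult_le[of X d Y] by simp
  qed
  have "cmod (F (of_real r)) \<le> T" by (rule three_lines[OF F]) (use b0 b1 r in auto)
  moreover have "F (of_real r) = mtrace (mpow d A (of_real r) * mpow d B (of_real (1 - r)))"
    unfolding F2 using P by simp
  ultimately show ?thesis using complex_Re_le_cmod order_trans unfolding T_def p_def q_def by metis
qed

section \<open>From all exponents in [1/2, 1) to all exponents in (0, 1)\<close>

definition strict_alt :: "nat \<Rightarrow> real \<Rightarrow> bool" where
  "strict_alt d r \<longleftrightarrow> (\<forall>A B. pos_def d A \<longrightarrow> pos_def d B \<longrightarrow> A * B \<noteq> B * A \<longrightarrow>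
     Re (mtrace (mpow d A (of_real r) * mpow d B (of_real r)))
       < Re (mtrace (mpow d (mpow d B (1/2) * A * mpow d B (1/2)) (of_real r))))"

lemma pos_def_sandwich:
  assumes "pos_def d A" "pos_def d B"
  shows "pos_def d (mpow d B (of_real s) * A * mpow d B (of_real s))"
  using pos_def_congruence[OF assms(1), of "mpow d B (of_real s)" "mpow d B (- of_real s)"] assms(2)
  by (simp add: adj_mpow mpow_add)

text \<open>The Araki-Lieb-Thirring inequality is a hypothesis at the single exponent a / (1 - a),
  so that the lemma serves both the descent to smaller exponents and the final theorem.\<close>

lemma measured_less_sandwiched:
  assumes \<rho>: "pos_def d \<rho>" and \<sigma>: "pos_def d \<sigma>" and nc: "\<rho> * \<sigma> \<noteq> \<sigma> * \<rho>" and a: "0 < a" "a < 1/2"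
    and alt: "strict_alt d (a / (1 - a))"
  defines "S \<equiv> mpow d \<sigma> (of_real ((1 - a) / (2 * a)))"
  shows "\<exists>Q. unitary d Q \<and> (\<Sum>i<d. diag_prob Q \<rho> i powr a * diag_prob Q \<sigma> i powr (1 - a))
    < Re (mtrace (mpow d (S * \<rho> * S) (of_real a)))"
proof -
  define r where "r = a / (1 - a)"
  have r: "0 < r" "r < 1" "r * (1 - a) = a" using a by (auto simp: r_def field_simps)
  define c where "c = (1 - a) / (2 * a)"
  have c: "c > 0" "2 * c * r = 1" using a by (auto simp: c_def r_def)
  define S' where "S' = mpow d \<sigma> (- of_real c)"
  have S: "S = mpow d \<sigma> (of_real c)" by (simp add: S_def c_def)
  have SC [simp]: "S \<in> carrier_mat d d" "S' \<in> carrier_mat d d" and \<rho>C [simp]: "\<rho> \<in> carrier_mat d d" "\<sigma> \<in> carrier_mat d d"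
    using \<sigma> \<rho> by (auto simp: S_def S'_def)
  have SS' [simp]: "S * (S' * Z) = Z" "S' * (S * Z) = Z" if "Z \<in> carrier_mat d d" for Z
    unfolding S S'_def using that \<sigma> by (simp_all add: mpow_mult_inverse)
  have SS'' [simp]: "S * S' = 1\<^sub>m d" "S' * S = 1\<^sub>m d" unfolding S S'_def using \<sigma> by (simp_all add: mpow_add)
  define X where "X = S * \<rho> * S"
  have X: "pos_def d X" unfolding X_def S by (rule pos_def_sandwich[OF \<rho> \<sigma>])
  note XC [simp] = mpow_carrier[OF X] pos_def_carrier[OF X]
  \<comment> \<open>The operator \<omega> of the overview; its eigenbasis is the
    measurement.\<close>
  define W where "W = S * mpow d X (of_real (a - 1)) * S"
  have W: "pos_def d W" unfolding W_def S by (rule pos_def_sandwich[OF mpow_pos_def[OF X] \<sigma>])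
  note WC [simp] = mpow_carrier[OF W] pos_def_carrier[OF W]
  define A where "A = mpow d W (of_real (- 1))"
  have A: "pos_def d A" unfolding A_def by (rule mpow_pos_def[OF W])
  have AC [simp]: "A \<in> carrier_mat d d" using A by simp
  have A_eq: "A = S' * (mpow d X (of_real (1 - a)) * S')"
  proof -
    let ?E = "S' * (mpow d X (of_real (1 - a)) * S')"
    have "W * ?E = S * ((mpow d X (of_real (a - 1)) * mpow d X (of_real (1 - a))) * S')"
      by (simp add: W_def mult_assoc_square[of _ d] del: of_real_diff)
    also have "\<dots> = 1\<^sub>m d" unfolding mpow_add[OF X] using X by (simp flip: of_real_add)
    finally have WE: "W * ?E = 1\<^sub>m d" .
    have "A * W = mpow d W (of_real (- 1)) * mpow d W 1" using W by (simp add: A_def)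
    also have "\<dots> = 1\<^sub>m d" unfolding mpow_add[OF W] using W by simp
    finally have "?E = (A * W) * ?E" by simp
    also have "\<dots> = A * (W * ?E)" by (simp add: mult_assoc_square[of _ d])
    also have "\<dots> = A" unfolding WE by simp
    finally show ?thesis ..
  qed
  \<comment> \<open>The exponent 2c is 1/r, so that B^r = \<sigma> and B^(1/2) = S at the same time.
    With A the inverse of W, the sandwiched product S A S collapses to X^(1-a).\<close>
  define B where "B = mpow d \<sigma> (of_real (2 * c))"
  have B: "pos_def d B" unfolding B_def by (rule mpow_pos_def[OF \<sigma>])
  have Bh: "mpow d B (1/2) = S" unfolding B_def S mpow_mpow[OF \<sigma>] by simp
  have Br: "mpow d B (of_real r) = \<sigma>"
    unfolding B_def mpow_mpow[OF \<sigma>] of_real_mult[symmetric] c using \<sigma> by simp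
  have SAS: "S * A * S = mpow d X (of_real (1 - a))" by (simp add: A_eq mult_assoc_square[of _ d])
  \<comment> \<open>If A commuted with B, hence with S, then X^(1-a) = S A S would commute with S,
    so X with \<sigma>; cancelling S on both sides gives \<rho> \<sigma> = \<sigma> \<rho>.\<close>
  have "A * B \<noteq> B * A"
  proof
    assume "A * B = B * A"
    then have "A * S = S * A"
      using mpow_intertwine[OF B B AC, of "1/2"] by (simp add: Bh)
    then have "mpow d X (of_real (1 - a)) * S = S * mpow d X (of_real (1 - a))"
      unfolding SAS[symmetric] by (simp add: mult_assoc_square[of _ d])
    then have "X * \<sigma> = \<sigma> * X" unfolding S using a c by (intro commute_mpow[OF X \<sigma>, of "1 - a" c]) auto
    moreover have S\<sigma>: "S * \<sigma> = \<sigma> * S" using mpow_intertwine[OF \<sigma> \<sigma> \<rho>C(2)] by (simp add: S)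
    have "X * \<sigma> = S * (\<rho> * (\<sigma> * S))" unfolding S\<sigma>[symmetric] by (simp add: X_def mult_assoc_square[of _ d])
    moreover have "\<sigma> * X = (\<sigma> * S) * (\<rho> * S)" by (simp add: X_def mult_assoc_square[of _ d])
    then have "\<sigma> * X = S * (\<sigma> * (\<rho> * S))" unfolding S\<sigma>[symmetric] by (simp add: mult_assoc_square[of _ d])
    ultimately have "S * (\<rho> * (\<sigma> * S)) = S * (\<sigma> * (\<rho> * S))" by simp
    then have "S' * (S * (\<rho> * (\<sigma> * S))) * S' = S' * (S * (\<sigma> * (\<rho> * S))) * S'" by simp
    then show False using nc by (simp add: mult_assoc_square[of _ d])
  qed
  then have "Re (mtrace (mpow d A (of_real r) * mpow d B (of_real r))) < Re (mtrace (mpow d (mpow d B (1/2) * A * mpow d B (1/2)) (of_real r)))"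
    using alt A B unfolding strict_alt_def r_def by blast
  then have "Re (mtrace (mpow d A (of_real r) * \<sigma>)) < Re (mtrace (mpow d X (of_real a)))"
    unfolding Br Bh SAS mpow_mpow[OF X] of_real_mult[symmetric] using r(3) by (simp add: mult.commute)
  moreover have "mpow d A (of_real r) = mpow d W (of_real (- r))"
    unfolding A_def mpow_mpow[OF W] by simp
  ultimately have lt: "Re (mtrace (\<sigma> * mpow d W (of_real (- r)))) < Re (mtrace (mpow d X (of_real a)))"
    by (simp add: mtrace_commute[of \<sigma> d])
  from pos_def_spectral[OF W] obtain Q w where Q: "unitary d Q"
    "W = Q * mat_diag d (\<lambda>i. complex_of_real (w i)) * adj Q" "\<And>i. w i > 0" by metis
  define p where "p = diag_prob Q \<rho>"
  define q where "q = diag_prob Q \<sigma>"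
  \<comment> \<open>Young's inequality is applied to p w and q w^(-r); the eigenvalue w cancels from
    the geometric mean because r (1 - a) = a.\<close>
  have "(\<Sum>i<d. p i powr a * q i powr (1 - a)) \<le> (\<Sum>i<d. a * (p i * w i) + (1 - a) * (q i * w i powr (- r)))"
  proof (rule sum_mono)
    fix i assume "i \<in> {..<d}"
    then have pq: "p i > 0" "q i > 0" using diag_prob_pos[OF \<rho> Q(1)] diag_prob_pos[OF \<sigma> Q(1)] by (auto simp: p_def q_def)
    have "(p i * w i) powr a * (q i * w i powr (- r)) powr (1 - a) = p i powr a * q i powr (1 - a) * (w i powr a * w i powr (- (r * (1 - a))))"
      using pq Q(3)[of i] by (simp add: powr_mult powr_powr)
    also have "\<dots> = p i powr a * q i powr (1 - a)" using Q(3)[of i] unfolding r(3) by (simp add: powr_minus)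
    finally show "p i powr a * q i powr (1 - a) \<le> a * (p i * w i) + (1 - a) * (q i * w i powr (- r))"
      using Youngs_inequality_0[of a "1 - a" "p i * w i" "q i * w i powr (- r)"] a pq Q(3)[of i] by simp
  qed
  also have "\<dots> = a * Re (mtrace (\<rho> * W)) + (1 - a) * Re (mtrace (\<sigma> * mpow d W (of_real (- r))))"
    by (simp only: mpow_of_real_eq[OF Q] Re_mtrace_mult_conj_diag[OF _ Q(1)] \<rho>C sum.distrib sum_distrib_left p_def q_def)
      (subst Q(2), simp only: Re_mtrace_mult_conj_diag[OF _ Q(1)] \<rho>C sum_distrib_left)
  also have "mtrace (\<rho> * W) = mtrace (mpow d X (of_real a))"
  proof -
    have "mtrace (\<rho> * W) = mtrace ((\<rho> * (S * mpow d X (of_real (a - 1)))) * S)"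
      by (simp add: W_def mult_assoc_square[of _ d])
    also have "\<dots> = mtrace (X * mpow d X (of_real (a - 1)))"
    proof -
      have "X * Z = S * (\<rho> * (S * Z))" if "Z \<in> carrier_mat d d" for Z
        using that by (simp add: X_def mult_assoc_square[of _ d])
      then show ?thesis by (subst mtrace_commute[of _ d]) simp_all
    qed
    also have "X * mpow d X (of_real (a - 1)) = mpow d X 1 * mpow d X (of_real (a - 1))" using X by simp
    finally show ?thesis unfolding mpow_add[OF X] by simp
  qed
  also have "a * Re (mtrace (mpow d X (of_real a))) + (1 - a) * Re (mtrace (\<sigma> * mpow d W (of_real (- r))))
    < a * Re (mtrace (mpow d X (of_real a))) + (1 - a) * Re (mtrace (mpow d X (of_real a)))"
    using lt a by simp
  finally show ?thesis using Q(1) unfolding p_def q_def X_def by (auto simp: algebra_simps)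
qed

text \<open>For \<sigma> = B^(r/(1-r)) the sandwiched trace at order r is tr[(B^(1/2) A B^(1/2))^r]
  and the Petz-Renyi trace is tr[A^r B^r]. One measurement lies strictly below the former and not
  below the latter.\<close>

lemma strict_alt_step:
  assumes alt: "strict_alt d (r / (1 - r))" and r: "0 < r" "r < 1/2"
  shows "strict_alt d r"
  unfolding strict_alt_def
proof (intro allI impI)
  fix A B assume A: "pos_def d A" and B: "pos_def d B" and nc: "A * B \<noteq> B * A"
  define \<sigma> where "\<sigma> = mpow d B (of_real (r / (1 - r)))"
  have \<sigma>: "pos_def d \<sigma>" unfolding \<sigma>_def by (rule mpow_pos_def[OF B])
  have "A * \<sigma> \<noteq> \<sigma> * A"
    using commute_mpow[OF A B, of 1 "r / (1 - r)"] nc r A unfolding \<sigma>_def by auto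
  from measured_less_sandwiched[OF A \<sigma> this r alt] obtain Q where Q: "unitary d Q"
    and lt: "(\<Sum>i<d. diag_prob Q A i powr r * diag_prob Q \<sigma> i powr (1 - r))
      < Re (mtrace (mpow d (mpow d \<sigma> (of_real ((1 - r) / (2 * r))) * A * mpow d \<sigma> (of_real ((1 - r) / (2 * r)))) (of_real r)))"
    by blast
  have "r / (1 - r) * ((1 - r) / (2 * r)) = 1/2" "r / (1 - r) * (1 - r) = r" using r by auto
  then have "mpow d \<sigma> (of_real ((1 - r) / (2 * r))) = mpow d B (of_real (1/2))" "mpow d \<sigma> (of_real (1 - r)) = mpow d B (of_real r)"
    unfolding \<sigma>_def mpow_mpow[OF B] of_real_mult[symmetric] by simp_all
  then show "Re (mtrace (mpow d A (of_real r) * mpow d B (of_real r)))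
      < Re (mtrace (mpow d (mpow d B (1/2) * A * mpow d B (1/2)) (of_real r)))"
    using lt petz_renyi_pinching[OF A \<sigma> Q, of r] r by simp
qed

text \<open>The map from r to r / (1 - r) lowers 1/r by exactly 1, so finitely many steps reach
  [1/2, 1). The induction is on n with 1/r \<le> n + 2.\<close>

theorem araki_lieb_thirring_strict:
  assumes "0 < r" "r < 1" shows "strict_alt d r"
proof -
  have "strict_alt d r" if "1 / (real n + 2) \<le> r" "r < 1" for n r
    using that
  proof (induction n arbitrary: r)
    case 0
    then show ?case unfolding strict_alt_def
      by (intro allI impI araki_lieb_thirring_strict_half) auto
  next
    case (Suc n)
    show ?case
    proof (cases "r < 1/2")
      case True
      have "0 < 1 / (real (Suc n) + 2)" by simp
      then have "r > 0" using Suc.prems(1) by linarith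
      moreover have "1 / (real n + 2) \<le> r / (1 - r)"
      proof -
        have "1 \<le> r * (real (Suc n) + 2)" using Suc.prems(1) by (subst (asm) pos_divide_le_eq) auto
        then have "1 - r \<le> r * (real n + 2)" by (simp add: algebra_simps)
        then have "(1 - r) / (real n + 2) \<le> r" by (subst pos_divide_le_eq) auto
        then show ?thesis using True by (subst pos_le_divide_eq) auto
      qed
      moreover have "r / (1 - r) < 1" using True by simp
      ultimately show ?thesis using Suc.IH strict_alt_step[OF _ _ True] by blast
    next
      case False
      then show ?thesis unfolding strict_alt_def
        by (intro allI impI araki_lieb_thirring_strict_half) (use Suc.prems in auto)
    qed
  qed
  moreover obtain n where "1 / r < real n" using reals_Archimedean2 by blast
  then have "1 < real n * r" using assms by (subst (asm) pos_divide_less_eq) auto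
  then have "1 \<le> r * (real n + 2)" using assms by (simp add: algebra_simps)
  then have "1 / (real n + 2) \<le> r" by (subst pos_divide_le_eq) auto
  ultimately show ?thesis using assms by blast
qed

section \<open>Translation to the Renyi quantities of the statement\<close>

lemma mat_fun_powr:
  assumes "pos_def d A" shows "mat_fun d (\<lambda>x. x powr s) A = mpow d A (of_real s)"
proof -
  from pos_def_spectral[OF assms] obtain U lam where U: "unitary d U"
    "A = U * mat_diag d (\<lambda>i. complex_of_real (lam i)) * adj U" "\<And>i. lam i > 0" by metis
  show ?thesis unfolding mat_fun_mfun mfun_eq[OF U(1,2)] mpow_of_real_eq[OF U] ..
qed

lemma outcome_prob_cinner:
  assumes "v \<in> carrier_vec d" "A \<in> carrier_mat d d"
  shows "outcome_prob v A = Re (cinner v (A *\<^sub>v v))"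
proof -
  have P: "proj v \<in> carrier_mat d d" using assms by (auto simp: proj_def)
  have "mtrace (proj v * A) = (\<Sum>i<d. \<Sum>j<d. v $ i * cnj (v $ j) * A $$ (j,i))"
    unfolding mtrace_mult[OF P assms(2)] using assms by (simp add: proj_def)
  also have "\<dots> = (\<Sum>j<d. \<Sum>i<d. v $ i * cnj (v $ j) * A $$ (j,i))" by (rule sum.swap)
  also have "\<dots> = cinner v (A *\<^sub>v v)"
    using assms by (auto simp: cinner_def scalar_prod_def sum_distrib_left atLeast0LessThan mult_ac intro!: sum.cong)
  finally show ?thesis by (simp add: outcome_prob_def)
qed

lemma outcome_prob_col:
  assumes "unitary d Q" "A \<in> carrier_mat d d" "i < d"
  shows "outcome_prob (col Q i) A = diag_prob Q A i"
  using assms unitary_carrier[OF assms(1)]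
  by (subst outcome_prob_cinner[of _ d]) (auto simp: diag_prob_def adj_mult_diag_index[of _ d])

lemma onb_cols: "unitary d Q \<Longrightarrow> onb d (cols Q)"
  using unitary_carrier[of d Q] cols_dim[of Q] by (auto simp: onb_def cinner_col_unitary)

lemma onb_unitary:
  assumes "onb d vs"
  obtains Q where "unitary d Q" "\<And>i. i < d \<Longrightarrow> vs ! i = col Q i"
proof
  define Q where "Q = mat_of_cols d vs"
  have len: "length vs = d" "set vs \<subseteq> carrier_vec d" using assms by (auto simp: onb_def)
  have Q: "Q \<in> carrier_mat d d" using len by (auto simp: Q_def)
  show c: "vs ! i = col Q i" if "i < d" for i using len that by (auto simp: Q_def subset_iff)
  have "adj Q * Q = 1\<^sub>m d"
  proof (rule eq_mat_square[of _ d])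
    fix i j assume ij: "i < d" "j < d"
    have "(adj Q * Q) $$ (i,j) = cinner (col Q i) (col Q j)"
      using ij Q by (auto simp: mult_index[of _ d d _ d] cinner_def)
    then show "(adj Q * Q) $$ (i,j) = 1\<^sub>m d $$ (i,j)" using ij assms by (simp add: onb_def flip: c)
  qed (use Q in auto)
  then show "unitary d Q" using Q by (simp add: unitary_def)
qed

text \<open>Makes the Petz-Renyi trace a usable lower bound for the infimum over bases; d > 0
  excludes the empty sum.\<close>

lemma Re_mtrace_mult_mpow_pos:
  assumes A: "pos_def d A" and B: "pos_def d B" and d: "d > 0"
  shows "Re (mtrace (mpow d A (of_real s) * mpow d B (of_real t))) > 0"
proof -
  from pos_def_spectral[OF B] obtain U lam where U: "unitary d U"
    "B = U * mat_diag d (\<lambda>i. complex_of_real (lam i)) * adj U" "\<And>i. lam i > 0" by metis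
  have "(\<Sum>i<d. diag_prob U (mpow d A (of_real s)) i * lam i powr t) > 0"
    using d U(3) diag_prob_pos[OF mpow_pos_def[OF A] U(1)] by (intro sum_pos) (auto simp: less_imp_neq[symmetric])
  then show ?thesis unfolding mpow_of_real_eq[OF U] using A by (simp add: Re_mtrace_mult_conj_diag[OF _ U(1)])
qed

theorem theorem7:
  fixes d :: nat and \<rho> \<sigma> :: "complex mat" and \<alpha> :: real
  assumes "density d \<rho>" and "pos_def d \<rho>"
    and "pos_semidef d \<sigma>" and "pos_def d \<sigma>"
    and "\<rho> * \<sigma> \<noteq> \<sigma> * \<rho>"
    and "0 < \<alpha>" and "\<alpha> < 1 / 2"
  shows "meas_renyi d \<alpha> \<rho> \<sigma> > sandwiched_renyi d \<alpha> \<rho> \<sigma> \<and>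
    (\<exists>vs. onb d vs \<and>
       classical_renyi \<alpha> (\<lambda>i. outcome_prob (vs ! i) \<rho>) (\<lambda>i. outcome_prob (vs ! i) \<sigma>) {..<d}
         > sandwiched_renyi d \<alpha> \<rho> \<sigma>)"
proof -
  define S where "S = mpow d \<sigma> (of_real ((1 - \<alpha>) / (2 * \<alpha>)))"
  define R where "R = Re (mtrace (mpow d (S * \<rho> * S) (of_real \<alpha>)))"
  define f where "f Q = (\<Sum>i<d. diag_prob Q \<rho> i powr \<alpha> * diag_prob Q \<sigma> i powr (1 - \<alpha>))" for Q
  note \<rho> = assms(2) and \<sigma> = assms(4) and nc = assms(5) and \<alpha> = assms(6,7)
  have SR: "sandwiched_renyi d \<alpha> \<rho> \<sigma> = 1 / (\<alpha> - 1) * ln R"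
    using \<sigma> pos_def_sandwich[OF \<rho> \<sigma>] by (simp add: sandwiched_renyi_def Let_def mat_fun_powr R_def S_def del: of_real_divide)
  \<comment> \<open>In dimension 0 all matrices commute.\<close>
  have d: "d > 0"
  proof (rule ccontr)
    assume "\<not> d > 0"
    then show False using nc pos_def_carrier[OF \<rho>] pos_def_carrier[OF \<sigma>] by (auto intro!: eq_matI)
  qed
  have f_onb: "(\<Sum>i<d. outcome_prob (vs ! i) \<rho> powr \<alpha> * outcome_prob (vs ! i) \<sigma> powr (1 - \<alpha>)) = f Q"
    if "unitary d Q" "\<And>i. i < d \<Longrightarrow> vs ! i = col Q i" for vs Q
    using that \<rho> \<sigma> by (simp add: f_def outcome_prob_col)
  \<comment> \<open>The Petz-Renyi trace is a positive lower bound common to all bases, so the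
    infimum, and not only each single sum, is a positive argument of \<open>ln\<close>.\<close>
  define c where "c = Re (mtrace (mpow d \<rho> (of_real \<alpha>) * mpow d \<sigma> (of_real (1 - \<alpha>))))"
  have c: "c > 0" unfolding c_def by (rule Re_mtrace_mult_mpow_pos[OF \<rho> \<sigma> d])
  have cf: "c \<le> f Q" if "unitary d Q" for Q
    unfolding c_def f_def using \<alpha> by (intro petz_renyi_pinching[OF \<rho> \<sigma> that]) auto
  have "strict_alt d (\<alpha> / (1 - \<alpha>))" using \<alpha> by (intro araki_lieb_thirring_strict) auto
  from measured_less_sandwiched[OF \<rho> \<sigma> nc \<alpha> this] obtain Q where Q: "unitary d Q" "f Q < R"
    unfolding f_def R_def S_def by blast
  have cols: "cols Q ! i = col Q i" if "i < d" for i using that unitary_carrier[OF Q(1)] by simp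
  have fQ: "(\<Sum>i<d. outcome_prob (cols Q ! i) \<rho> powr \<alpha> * outcome_prob (cols Q ! i) \<sigma> powr (1 - \<alpha>)) = f Q"
    by (rule f_onb[OF Q(1)]) (rule cols)
  \<comment> \<open>The prefactor is negative, so a smaller sum means a larger divergence.\<close>
  have gt: "1 / (\<alpha> - 1) * ln x > sandwiched_renyi d \<alpha> \<rho> \<sigma>" if "0 < x" "x < R" for x
  proof -
    have "ln x < ln R" using that by simp
    then show ?thesis unfolding SR using \<alpha> by (simp add: divide_strict_right_mono_neg)
  qed
  define M where "M = {\<Sum>i<d. outcome_prob (vs ! i) \<rho> powr \<alpha> * outcome_prob (vs ! i) \<sigma> powr (1 - \<alpha>) | vs. onb d vs}"
  have fM: "f Q \<in> M" unfolding M_def using fQ[symmetric] onb_cols[OF Q(1)] by blast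
  have cM: "c \<le> x" if "x \<in> M" for x
  proof -
    from that obtain vs where vs: "onb d vs"
      "x = (\<Sum>i<d. outcome_prob (vs ! i) \<rho> powr \<alpha> * outcome_prob (vs ! i) \<sigma> powr (1 - \<alpha>))" by (auto simp: M_def)
    from onb_unitary[OF vs(1)] obtain Q' where Q': "unitary d Q'" "\<And>i. i < d \<Longrightarrow> vs ! i = col Q' i" by metis
    have "x = f Q'" unfolding vs(2) by (rule f_onb[OF Q'])
    then show ?thesis using cf[OF Q'(1)] by simp
  qed
  have "Inf M \<le> f Q" using fM cM by (intro cInf_lower bdd_belowI)
  moreover have "c \<le> Inf M" using fM cM by (intro cInf_greatest) auto
  ultimately have "meas_renyi d \<alpha> \<rho> \<sigma> > sandwiched_renyi d \<alpha> \<rho> \<sigma>"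
    unfolding meas_renyi_def M_def[symmetric] using gt c Q(2) by auto
  moreover have "classical_renyi \<alpha> (\<lambda>i. outcome_prob (cols Q ! i) \<rho>) (\<lambda>i. outcome_prob (cols Q ! i) \<sigma>) {..<d}
      > sandwiched_renyi d \<alpha> \<rho> \<sigma>"
    unfolding classical_renyi_def fQ using cf[OF Q(1)] c Q(2) by (intro gt) auto
  ultimately show ?thesis using onb_cols[OF Q(1)] by blast
qed

end
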